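(* Let $w \in C_2$. The following are equivalent. (1) $w$ is minimal. (2) $|(ab)_w - (a\overline{b})_w| \leq \min((aa)_w, (bb)_w)$. (3) $|(yx)_w - (y\overline{x})_w| \leq \min((xx)_w, (yy)_w)$ for some $x, y \in L_2$ with $x \notin \{y,\overline{y}\}$.
   Context: $F_2$ is the free group on generators $a,b$; $\overline{x}$ denotes the inverse of $x$ (so $\overline{\overline{x}}=x$), and $L_2=\{a,b,\overline{a},\overline{b}\}$ is the set of letters. Each element of $F_2$ is identified with its freely reduced word over $L_2$, and $|w|$ is the length of that word. $C_2$ is the set of cyclically reduced words: $w=w_1\cdots w_\ell\in F_2$ with $w_\ell\neq\overline{w_1}$ (the empty word is included). A word $w\in F_2$ is minimal if $|w|\le|\phi(w)|$ for all $\phi\in\operatorname{Aut}F_2$. Subword counts: for a word $w=w_1\cdots w_\ell$ and a nonempty word $v$ on $L_2$ with $k=|v|\le\ell$, $[v]_w$ is the number of (possibly overlapping) occurrences of $v$ as a contiguous subword of $w_1\cdots w_\ell w_1\cdots w_{k-1}$; if $|v|>|w|$, $[v]_w=0$. Set $(v)_w=[v]_w+[v^{-1}]_w$. *)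

theory Defs
  imports "HOL-Algebra.Bij"
begin

text \<open>
  The free group on two generators, with carrier the freely reduced words over the four letters.
  The letters \<open>A_inv\<close> and \<open>B_inv\<close> are the inverses of the generators \<open>A\<close> and \<open>B\<close>.
\<close>

datatype letter = A | B | A_inv | B_inv

fun bar :: "letter \<Rightarrow> letter" where
  "bar A = A_inv"
| "bar B = B_inv"
| "bar A_inv = A"
| "bar B_inv = B"

definition reduced :: "letter list \<Rightarrow> bool" where
  "reduced w \<longleftrightarrow> successively (\<lambda>x y. y \<noteq> bar x) w"

fun cons_reduce :: "letter \<Rightarrow> letter list \<Rightarrow> letter list" where
  "cons_reduce x [] = [x]"
| "cons_reduce x (y # w) = (if y = bar x then w else x # y # w)"

definition reduce :: "letter list \<Rightarrow> letter list" where
  "reduce w = foldr cons_reduce w []"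

definition F2 :: "letter list monoid" where
  "F2 = \<lparr>carrier = {w. reduced w}, mult = (\<lambda>u v. reduce (u @ v)), one = []\<rparr>"

definition word_inv :: "letter list \<Rightarrow> letter list" where
  "word_inv w = rev (map bar w)"

definition C2 :: "letter list set" where
  "C2 = {w \<in> carrier F2. w = [] \<or> last w \<noteq> bar (hd w)}"

definition minimal :: "letter list \<Rightarrow> bool" where
  "minimal w \<longleftrightarrow> w \<in> carrier F2 \<and> (\<forall>\<phi> \<in> auto F2. length w \<le> length (\<phi> w))"

text \<open>
  Only nonempty \<open>v\<close> are relevant below. The index \<open>i\<close> is the starting position of an occurrence
  of \<open>v\<close> in \<open>w\<close> read cyclically.
\<close>

definition occ :: "letter list \<Rightarrow> letter list \<Rightarrow> nat" where
  "occ v w =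
    (if length v \<le> length w then
       (let u = w @ take (length v - 1) w
        in card {i. i + length v \<le> length u \<and> take (length v) (drop i u) = v})
     else 0)"

definition count_pm :: "letter list \<Rightarrow> letter list \<Rightarrow> nat" where
  "count_pm v w = occ v w + occ (word_inv v) w"


lemma bar_bar [simp]: "bar (bar x) = x"
  by (cases x) auto

lemma bar_neq [simp]: "bar x \<noteq> x" "x \<noteq> bar x"
  by (cases x; simp)+

lemma bar_eq_iff [simp]: "bar x = bar y \<longleftrightarrow> x = y"
  by (metis bar_bar)

lemma reduced_Nil [simp]: "reduced []"
  by (simp add: reduced_def)

lemma reduced_Cons: "reduced (x # w) \<longleftrightarrow> (w = [] \<or> hd w \<noteq> bar x) \<and> reduced w"
  by (cases w) (auto simp: reduced_def)

lemma reduced_cons_reduce: "reduced w \<Longrightarrow> reduced (cons_reduce x w)"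
  by (cases w) (auto simp: reduced_Cons)

lemma reduced_foldr: "reduced z \<Longrightarrow> reduced (foldr cons_reduce w z)"
  by (induction w) (auto simp: reduced_cons_reduce)

lemma reduced_reduce [simp]: "reduced (reduce w)"
  by (simp add: reduce_def reduced_foldr)

lemma cons_reduce_cancel: "reduced z \<Longrightarrow> cons_reduce x (cons_reduce (bar x) z) = z"
  by (cases z rule: list.exhaust[case_product list.exhaust[of "tl z"]]) (auto simp: reduced_Cons)

lemma foldr_cons_reduce:
  assumes "reduced z"
  shows "foldr cons_reduce (cons_reduce x u) z = cons_reduce x (foldr cons_reduce u z)"
proof (cases u)
  case (Cons y v)
  then show ?thesis
    using cons_reduce_cancel[OF reduced_foldr[OF assms, of v], of x] by auto
qed simp

lemma foldr_reduce:
  "reduced z \<Longrightarrow> foldr cons_reduce (reduce u) z = foldr cons_reduce u z"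
proof (induction u)
  case (Cons x u)
  have "reduce (x # u) = cons_reduce x (reduce u)"
    by (simp add: reduce_def)
  with Cons show ?case by (simp add: foldr_cons_reduce)
qed (simp add: reduce_def)

lemma reduce_append_left: "reduce (reduce u @ v) = reduce (u @ v)"
proof -
  have "foldr cons_reduce (reduce u) (reduce v) = foldr cons_reduce u (reduce v)"
    by (rule foldr_reduce) simp
  then show ?thesis by (simp add: reduce_def)
qed

lemma reduce_reduced: "reduced w \<Longrightarrow> reduce w = w"
proof (induction w)
  case (Cons x w)
  then show ?case by (cases w) (auto simp: reduce_def reduced_Cons)
qed (simp add: reduce_def)

lemma reduce_append_right: "reduce (u @ reduce v) = reduce (u @ v)"
  using reduce_reduced[OF reduced_reduce, of v] by (simp add: reduce_def)

lemma foldr_word_inv_append: "reduced z \<Longrightarrow> foldr cons_reduce (word_inv w @ w) z = z"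
proof (induction w arbitrary: z)
  case (Cons x w)
  have "foldr cons_reduce (word_inv (x # w) @ x # w) z =
      foldr cons_reduce (word_inv w)
        (cons_reduce (bar x) (cons_reduce (bar (bar x)) (foldr cons_reduce w z)))"
    by (simp add: word_inv_def)
  also have "\<dots> = foldr cons_reduce (word_inv w @ w) z"
    by (simp only: cons_reduce_cancel[OF reduced_foldr[OF Cons.prems]] foldr_append)
  finally show ?case using Cons by simp
qed (simp add: word_inv_def)

lemma reduced_word_inv: "reduced w \<Longrightarrow> reduced (word_inv w)"
proof -
  assume "reduced w"
  then have "successively (\<lambda>x y. y \<noteq> bar x) w" by (simp add: reduced_def)
  then have "successively (\<lambda>x y. x \<noteq> bar y) w"
    by (rule successively_mono) auto
  then show ?thesis
    by (simp add: reduced_def word_inv_def successively_map)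
qed

lemma group_F2: "group F2"
proof (rule groupI)
  fix x y z assume "x \<in> carrier F2" "y \<in> carrier F2" "z \<in> carrier F2"
  then show "x \<otimes>\<^bsub>F2\<^esub> y \<otimes>\<^bsub>F2\<^esub> z = x \<otimes>\<^bsub>F2\<^esub> (y \<otimes>\<^bsub>F2\<^esub> z)"
    by (simp add: F2_def reduce_append_left reduce_append_right)
next
  fix x assume "x \<in> carrier F2"
  then show "\<exists>y\<in>carrier F2. y \<otimes>\<^bsub>F2\<^esub> x = \<one>\<^bsub>F2\<^esub>"
    using reduced_word_inv foldr_word_inv_append[OF reduced_Nil, of x]
    by (intro bexI[of _ "word_inv x"]) (auto simp: F2_def reduce_def)
qed (auto simp: F2_def reduce_reduced)

lemma inv_F2: "w \<in> carrier F2 \<Longrightarrow> inv\<^bsub>F2\<^esub> w = word_inv w"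
  using reduced_word_inv foldr_word_inv_append[OF reduced_Nil, of w]
  by (intro group.inv_equality[OF group_F2]) (auto simp: F2_def reduce_def)

end

theory Submission
  imports Defs
begin

text \<open>
  The inequality says that no transvection \<open>a \<mapsto> a b\<^sup>\<plusminus>\<close>, \<open>b \<mapsto> b a\<^sup>\<plusminus>\<close> shortens the cyclic word
  \<open>w\<close>: the substitution \<open>a \<mapsto> a b\<close> adds a letter for each \<open>a\<^sup>\<plusminus>\<close> and cancels two letters for each
  \<open>a b\<inverse>\<close> or its inverse, so the cyclic length changes by \<open>(aa) + (ab) - (ab\<inverse>)\<close>, and similarly for the
  others (\<open>clen_transvection_count\<close>). The third condition speaks of the
  same four transvections, because the difference of the mixed counts is symmetric in the two
  letters (\<open>count_pm_commute\<close>) and inverting a letter only changes its sign. A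
  minimal word clearly satisfies the inequality. The point is the converse: a word that is a local
  minimum under transvections is a global minimum under all automorphisms.

  The reason is convexity. Consider the bases of the free group up to conjugation and signs; two of
  them are adjacent if a transvection links them. They form the edges of the Farey triangulation,
  whose dual is a tree. If one leaves a basis on one side of its edge by a transvection and on the other
  side by another one, then the cyclic lengths of \<open>w\<close> with respect to the two new bases add up to at
  least twice the old one (\<open>clen_convex_same\<close>, \<open>clen_convex_mixed\<close>). Thus along a path in the
  tree the cyclic length never decreases again once a step has not decreased it
  (\<open>clen_positive\<close>).

  That every automorphism is reached by such a path is \<open>normal_form_invertible\<close>: up to an inner
  automorphism and signed permutations of the letters it is a product of the positive transvections
  \<open>a \<mapsto> a b\<close> and \<open>b \<mapsto> b a\<close>. It follows from Nielsen reduction of the pair of images of the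
  generators (\<open>Nielsen_irreducible_is_letters\<close>), together with the fact that these normal forms are closed
  under composition with transvections (\<open>normal_form_transvection\<close>).

  Automorphisms are represented by substitutions on unreduced words, and cyclic words by the growth
  of the powers of a linear word (\<open>rlen_wpow_bounds\<close>).
\<close>


section \<open>Words up to free reduction\<close>

abbreviation free_eq :: "letter list \<Rightarrow> letter list \<Rightarrow> bool" (infix "\<simeq>" 50) where
  "u \<simeq> v \<equiv> reduce u = reduce v"

abbreviation rlen :: "letter list \<Rightarrow> nat" where
  "rlen w \<equiv> length (reduce w)"

lemma reduce_Nil [simp]: "reduce [] = []"
  by (simp add: reduce_def)

lemma reduce_Cons: "reduce (x # w) = cons_reduce x (reduce w)"
  by (simp add: reduce_def)

lemma reduce_reduce [simp]: "reduce (reduce w) = reduce w"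
  by (simp add: reduce_reduced)

lemma free_eq_append: "u \<simeq> u' \<Longrightarrow> v \<simeq> v' \<Longrightarrow> u @ v \<simeq> u' @ v'"
  by (metis reduce_append_left reduce_append_right)

lemma length_cons_reduce: "length (cons_reduce x w) \<le> Suc (length w)"
  by (cases w) auto

lemma rlen_le: "rlen w \<le> length w"
proof (induction w)
  case (Cons x w)
  then show ?case using length_cons_reduce[of x "reduce w"] by (simp add: reduce_Cons)
qed simp

lemma rlen_append: "rlen (u @ v) \<le> rlen u + rlen v"
proof -
  have "rlen (u @ v) = rlen (reduce u @ reduce v)"
    by (simp add: reduce_append_left reduce_append_right)
  then show ?thesis using rlen_le[of "reduce u @ reduce v"] by simp
qed

lemma word_inv_Nil [simp]: "word_inv [] = []"
  and word_inv_Cons: "word_inv (x # w) = word_inv w @ [bar x]"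
  and word_inv_append [simp]: "word_inv (u @ v) = word_inv v @ word_inv u"
  and length_word_inv [simp]: "length (word_inv w) = length w"
  by (simp_all add: word_inv_def)

lemma word_inv_word_inv [simp]: "word_inv (word_inv w) = w"
  by (simp add: word_inv_def rev_map o_def)

lemma inv_append_self: "word_inv w @ w \<simeq> []"
  using foldr_word_inv_append[of "[]" w] by (simp add: reduce_def)

lemma self_append_inv: "w @ word_inv w \<simeq> []"
  using inv_append_self[of "word_inv w"] by simp

lemma cancel_inv_left: "word_inv w @ w @ v \<simeq> v"
  using free_eq_append[OF inv_append_self[of w], of v v] by simp

lemma cancel_left_inv: "w @ word_inv w @ v \<simeq> v"
  using cancel_inv_left[of "word_inv w" v] by simp

text \<open>
  Inverses modulo free reduction are unique, so inverting is compatible with \<open>\<simeq>\<close>.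
\<close>

lemma word_inv_cong: assumes "u \<simeq> v" shows "word_inv u \<simeq> word_inv v"
proof -
  have "word_inv u \<simeq> word_inv u @ (v @ word_inv v)"
    using free_eq_append[OF refl self_append_inv[of v], of "word_inv u"] by simp
  also have "\<dots> = reduce (word_inv u @ (u @ word_inv v))"
    by (intro free_eq_append refl) (simp add: assms)
  also have "\<dots> = reduce (word_inv v)" by (rule cancel_inv_left)
  finally show ?thesis .
qed

lemma reduce_word_inv: "reduce (word_inv w) = word_inv (reduce w)"
proof -
  have "word_inv w \<simeq> word_inv (reduce w)" by (rule word_inv_cong) simp
  then show ?thesis by (simp add: reduce_reduced reduced_word_inv)
qed

lemma rlen_word_inv [simp]: "rlen (word_inv w) = rlen w"
  by (simp add: reduce_word_inv)

lemma reduced_append: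
  "reduced (u @ v) \<longleftrightarrow> reduced u \<and> reduced v \<and> (u = [] \<or> v = [] \<or> hd v \<noteq> bar (last u))"
  by (simp add: reduced_def successively_append_iff)

lemma reduced_Cons_Cons: "reduced (x # y # w) \<longleftrightarrow> y \<noteq> bar x \<and> reduced (y # w)"
  by (simp add: reduced_Cons)

lemma reduced_single [simp]: "reduced [x]"
  by (simp add: reduced_Cons)

lemma word_inv_single [simp]: "word_inv [x] = [bar x]"
  by (simp add: word_inv_def)


section \<open>Substitutions\<close>

abbreviation subst :: "(letter \<Rightarrow> letter list) \<Rightarrow> letter list \<Rightarrow> letter list" where
  "subst f w \<equiv> concat (map f w)"

text \<open>
  The substitutions that descend to endomorphisms of the free group are those that send inverse
  letters to inverse words. Asking for this on the nose, and not only up to free reduction, makes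
  composition and inversion of substitutions exact identities between lists.
\<close>

definition inv_compat :: "(letter \<Rightarrow> letter list) \<Rightarrow> bool" where
  "inv_compat f \<longleftrightarrow> (\<forall>x. f (bar x) = word_inv (f x))"

lemma inv_compatD: "inv_compat f \<Longrightarrow> f (bar x) = word_inv (f x)"
  by (simp add: inv_compat_def)

lemma subst_word_inv: "inv_compat f \<Longrightarrow> subst f (word_inv w) = word_inv (subst f w)"
  by (induction w) (auto simp: word_inv_Cons inv_compatD)

lemma subst_reduce: assumes "inv_compat f" shows "subst f (reduce w) \<simeq> subst f w"
proof (induction w)
  case (Cons x w)
  have *: "subst f (cons_reduce x v) \<simeq> f x @ subst f v" for v
  proof (cases v)
    case (Cons y v')
    then show ?thesis
      using cancel_left_inv[of "f x" "subst f v'"] inv_compatD[OF assms] by auto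
  qed simp
  show ?case using *[of "reduce w"] free_eq_append[OF refl Cons, of "f x"]
    by (simp add: reduce_Cons)
qed simp

lemma subst_cong: assumes "inv_compat f" "u \<simeq> v" shows "subst f u \<simeq> subst f v"
  by (metis assms subst_reduce)

text \<open>Words form a free monoid, so substitutions compose without any reduction.\<close>

lemma subst_subst: "subst f (subst g w) = subst (\<lambda>x. subst f (g x)) w"
  by (induction w) auto

lemma inv_compat_comp: "inv_compat f \<Longrightarrow> inv_compat g \<Longrightarrow> inv_compat (\<lambda>x. subst f (g x))"
  by (simp add: inv_compat_def subst_word_inv)

lemma inv_compat_conj: "inv_compat f \<Longrightarrow> inv_compat (\<lambda>x. h @ f x @ word_inv h)"
  by (simp add: inv_compat_def)

lemma subst_conj: "subst (\<lambda>x. h @ f x @ word_inv h) w \<simeq> h @ subst f w @ word_inv h"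
proof (induction w)
  case Nil
  show ?case by (simp add: self_append_inv)
next
  case (Cons x w)
  have "subst (\<lambda>x. h @ f x @ word_inv h) (x # w)
        \<simeq> (h @ f x @ word_inv h) @ (h @ subst f w @ word_inv h)"
    using free_eq_append[OF refl Cons, of "h @ f x @ word_inv h"] by simp
  also have "\<dots> = reduce ((h @ f x) @ (word_inv h @ h @ subst f w @ word_inv h))" by simp
  also have "\<dots> = reduce ((h @ f x) @ (subst f w @ word_inv h))"
    by (intro free_eq_append refl cancel_inv_left)
  finally show ?case by simp
qed

lemma subst_eqI:
  assumes "inv_compat f" "inv_compat g" "f A \<simeq> g A" "f B \<simeq> g B"
  shows "subst f w \<simeq> subst g w"
proof (induction w)
  case (Cons x w)
  have "f x \<simeq> g x"
    using assms(3,4) word_inv_cong[OF assms(3)] word_inv_cong[OF assms(4)]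
      inv_compatD[OF assms(1), of A] inv_compatD[OF assms(1), of B]
      inv_compatD[OF assms(2), of A] inv_compatD[OF assms(2), of B]
    by (cases x) auto
  from free_eq_append[OF this Cons] show ?case by simp
qed simp


section \<open>Signed permutations and transvections\<close>

text \<open>
  The automorphisms that permute the letters; they preserve reduced words and lengths. Together with
  the transvections \<open>x \<mapsto> x y\<close> and the inner automorphisms they generate the automorphism group.
\<close>

definition signed :: "(letter \<Rightarrow> letter) \<Rightarrow> bool" where
  "signed s \<longleftrightarrow> bij s \<and> (\<forall>x. s (bar x) = bar (s x))"

lemma signed_inj: "signed s \<Longrightarrow> s x = s y \<longleftrightarrow> x = y"
  by (auto simp: signed_def bij_def inj_eq)

lemma signed_bar: "signed s \<Longrightarrow> s (bar x) = bar (s x)"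
  by (simp add: signed_def)

lemma signed_id: "signed id" "signed (\<lambda>x. x)"
  by (simp_all add: signed_def bij_id[unfolded id_def])

lemma signed_comp: "signed s \<Longrightarrow> signed t \<Longrightarrow> signed (\<lambda>x. s (t x))"
  using bij_comp[of t s] by (auto simp: signed_def o_def)

lemma signed_if_inj: assumes "inj s" "\<And>x. s (bar x) = bar (s x)" shows "signed s"
proof -
  have "(UNIV :: letter set) = {A, B, A_inv, B_inv}" by (auto intro: letter.exhaust)
  then have "finite (UNIV :: letter set)" by (metis finite.emptyI finite_insert)
  with assms show ?thesis by (simp add: signed_def bij_def finite_UNIV_inj_surj)
qed

lemma signed_inv: assumes "signed s"
  obtains t where "signed t" "\<And>x. t (s x) = x" "\<And>x. s (t x) = x"
proof
  let ?t = "inv_into UNIV s"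
  have b: "bij s" using assms by (simp add: signed_def)
  show 1: "?t (s x) = x" for x using b by (simp add: bij_is_inj)
  show 2: "s (?t x) = x" for x using b by (simp add: bij_is_surj surj_f_inv_f)
  have "?t (bar x) = bar (?t x)" for x
    by (metis 1 2 assms signed_bar)
  then show "signed ?t" using b by (simp add: signed_def bij_imp_bij_inv)
qed

lemma subst_letters [simp]: "subst (\<lambda>x. [s x]) w = map s w"
  by (induction w) auto

lemma inv_compat_letters: "signed s \<Longrightarrow> inv_compat (\<lambda>x. [s x])"
  by (simp add: inv_compat_def signed_bar)

lemma map_cong_free: "signed s \<Longrightarrow> u \<simeq> v \<Longrightarrow> map s u \<simeq> map s v"
  using subst_cong[OF inv_compat_letters, of s u v] by simp

lemma map_word_inv: "signed s \<Longrightarrow> map s (word_inv w) = word_inv (map s w)"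
  using subst_word_inv[OF inv_compat_letters] by simp

lemma reduce_map: assumes "signed s" shows "reduce (map s w) = map s (reduce w)"
proof (induction w)
  case (Cons x w)
  have "cons_reduce (s x) (map s v) = map s (cons_reduce x v)" for v
    using assms by (cases v) (auto simp: signed_bar[symmetric] signed_inj)
  with Cons show ?case by (simp add: reduce_Cons)
qed simp

definition transvection :: "letter \<Rightarrow> letter \<Rightarrow> letter \<Rightarrow> letter list" where
  "transvection x y z = (if z = x then [x, y] else if z = bar x then [bar y, bar x] else [z])"

lemma inv_compat_transvection: "inv_compat (transvection x y)"
  by (auto simp: inv_compat_def transvection_def word_inv_def)

lemma transvection_map: assumes "signed s"
  shows "map s (subst (transvection x y) w) = subst (transvection (s x) (s y)) (map s w)"
  using assms
  by (induction w) (auto simp: transvection_def signed_bar[symmetric] signed_inj)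

text \<open>
  The transvection \<open>x \<mapsto> y\<inverse> x\<close> differs from \<open>x \<mapsto> x y\<inverse>\<close> by an inner automorphism, so
  that up to conjugation only four transvections remain.
\<close>

lemma transvection_bar: assumes "y \<notin> {x, bar x}"
  shows "subst (transvection (bar x) y) w \<simeq> [bar y] @ subst (transvection x (bar y)) w @ [y]"
proof -
  let ?f = "\<lambda>z. [bar y] @ transvection x (bar y) z @ word_inv [bar y]"
  have "transvection (bar x) y z \<simeq> ?f z" for z
    using assms by (cases x; cases y; cases z) (auto simp: transvection_def reduce_def)
  then have "subst (transvection (bar x) y) w \<simeq> subst ?f w"
    by (intro subst_eqI inv_compat_transvection inv_compat_conj) auto
  also have "\<dots> = reduce ([bar y] @ subst (transvection x (bar y)) w @ [y])"
    using subst_conj[of "[bar y]"] by simp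
  finally show ?thesis .
qed

lemma transvection_cancel: assumes "y \<notin> {x, bar x}"
  shows "subst (transvection x y) (subst (transvection x (bar y)) w) \<simeq> w"
proof -
  have "subst (transvection x y) (transvection x (bar y) z) \<simeq> [z]" for z
    using assms by (cases x; cases y; cases z) (auto simp: transvection_def reduce_def)
  then have "subst (\<lambda>z. subst (transvection x y) (transvection x (bar y) z)) w \<simeq> subst (\<lambda>z. [z]) w"
    by (intro subst_eqI inv_compat_comp inv_compat_transvection)
      (auto simp: inv_compat_def)
  then show ?thesis by (simp add: subst_subst)
qed


section \<open>Cyclic length\<close>

text \<open>
  A minimum over all conjugates is invariant under conjugation and attained by design; that it is the
  length for cyclically reduced words is \<open>clen_C2\<close>.
\<close>

definition clen :: "letter list \<Rightarrow> nat" where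
  "clen w = (LEAST k. \<exists>h. k = rlen (h @ w @ word_inv h))"

lemma clen_attained: obtains h where "clen w = rlen (h @ w @ word_inv h)"
  using LeastI_ex[of "\<lambda>k. \<exists>h. k = rlen (h @ w @ word_inv h)"] by (auto simp: clen_def)

lemma clen_le_conj: "clen w \<le> rlen (h @ w @ word_inv h)"
  unfolding clen_def by (rule Least_le) auto

lemma clen_le: "clen w \<le> rlen w"
  using clen_le_conj[of w "[]"] by simp

lemma clen_cong: assumes "u \<simeq> v" shows "clen u = clen v"
proof -
  have "h @ u @ word_inv h \<simeq> h @ v @ word_inv h" for h
    by (intro free_eq_append refl assms)
  then show ?thesis by (simp add: clen_def)
qed

lemma clen_conj: "clen (g @ w @ word_inv g) = clen w"
proof (rule antisym)
  obtain h where h: "clen w = rlen (h @ w @ word_inv h)" by (rule clen_attained)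
  have "(h @ word_inv g) @ (g @ w @ word_inv g) @ word_inv (h @ word_inv g)
     \<simeq> h @ w @ word_inv h"
    using free_eq_append[OF refl cancel_inv_left[of g "w @ word_inv g @ g @ word_inv h"], of h]
      free_eq_append[OF refl cancel_inv_left[of g "word_inv h"], of "h @ w"]
    by simp
  then show "clen (g @ w @ word_inv g) \<le> clen w"
    by (metis h clen_le_conj)
  obtain h' where "clen (g @ w @ word_inv g) = rlen (h' @ (g @ w @ word_inv g) @ word_inv h')"
    by (rule clen_attained)
  then show "clen w \<le> clen (g @ w @ word_inv g)"
    using clen_le_conj[of w "h' @ g"] by simp
qed

lemma clen_conj': "w \<simeq> g @ u @ word_inv g \<Longrightarrow> clen w = clen u"
  using clen_cong[of w "g @ u @ word_inv g"] by (simp add: clen_conj)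

abbreviation wpow :: "nat \<Rightarrow> letter list \<Rightarrow> letter list" where
  "wpow n w \<equiv> concat (replicate n w)"

lemma wpow_cong: "u \<simeq> v \<Longrightarrow> wpow n u \<simeq> wpow n v"
  by (induction n) (auto intro: free_eq_append)

lemma wpow_conj: "wpow n (h @ w @ word_inv h) \<simeq> h @ wpow n w @ word_inv h"
proof (induction n)
  case 0
  show ?case by (simp add: self_append_inv)
next
  case (Suc n)
  have "wpow (Suc n) (h @ w @ word_inv h)
        \<simeq> (h @ w @ word_inv h) @ (h @ wpow n w @ word_inv h)"
    using free_eq_append[OF refl Suc, of "h @ w @ word_inv h"] by simp
  also have "\<dots> = reduce ((h @ w) @ (word_inv h @ h @ wpow n w @ word_inv h))" by simp
  also have "\<dots> = reduce ((h @ w) @ (wpow n w @ word_inv h))"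
    by (intro free_eq_append refl cancel_inv_left)
  finally show ?case by simp
qed

lemma subst_wpow: "subst f (wpow n w) = wpow n (subst f w)"
  by (induction n) auto

lemma C2_iff: "w \<in> C2 \<longleftrightarrow> reduced w \<and> (w = [] \<or> last w \<noteq> bar (hd w))"
  by (simp add: C2_def F2_def)

lemma last_neq_bar_hd_iff: "last w \<noteq> bar (hd w) \<longleftrightarrow> hd w \<noteq> bar (last w)"
  by (metis bar_bar)

lemma reduced_wpow: assumes "w \<in> C2" shows "reduced (wpow n w)"
proof (cases "w = []")
  case False
  show ?thesis
  proof (induction n)
    case (Suc n)
    show ?case
    proof (cases n)
      case (Suc m)
      then have "hd (wpow n w) = hd w" using False by simp
      with Suc.IH assms show ?thesis
        by (auto simp: reduced_append C2_iff last_neq_bar_hd_iff)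
    qed (use assms in \<open>simp add: C2_iff\<close>)
  qed simp
qed (simp add: concat_replicate_trivial)

lemma length_wpow: "length (wpow n w) = n * length w"
  by (induction n) auto

lemma rlen_wpow_C2: "w \<in> C2 \<Longrightarrow> rlen (wpow n w) = n * length w"
  by (simp add: reduce_reduced reduced_wpow length_wpow)

text \<open>
  A shortest conjugate is cyclically reduced: otherwise conjugating by its first letter would cancel
  both ends.
\<close>

lemma cyclic_core:
  obtains h c where "c \<in> C2" "length c = clen w" "c \<simeq> h @ w @ word_inv h"
proof -
  obtain h where h: "clen w = rlen (h @ w @ word_inv h)" by (rule clen_attained)
  define c where "c = reduce (h @ w @ word_inv h)"
  have eq: "c \<simeq> h @ w @ word_inv h" by (simp add: c_def)
  have red: "reduced c" by (simp add: c_def)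
  have "c \<in> C2"
  proof (rule ccontr)
    assume "c \<notin> C2"
    then have ne: "c \<noteq> []" and last: "last c = bar (hd c)" using red by (auto simp: C2_iff)
    obtain x d where xd: "c = x # d" using ne by (cases c) auto
    with last have "d \<noteq> []" by auto
    then obtain e where e: "c = x # e @ [bar x]"
      using xd last by (metis append_butlast_last_id last_ConsR list.sel(1))
    have "[bar x] @ c @ [x] \<simeq> e"
    proof -
      have "[bar x] @ c @ [x] = word_inv [x] @ [x] @ (e @ word_inv [x] @ [x])"
        by (simp add: e)
      also have "\<dots> \<simeq> e @ (word_inv [x] @ [x])" by (rule cancel_inv_left)
      also have "\<dots> = reduce (e @ [])" by (intro free_eq_append refl inv_append_self)
      finally show ?thesis by simp
    qed
    moreover have "([bar x] @ h) @ w @ word_inv ([bar x] @ h)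
        \<simeq> [bar x] @ c @ [x]"
    proof -
      have "[bar x] @ (h @ w @ word_inv h) @ [x] \<simeq> [bar x] @ c @ [x]"
        by (intro free_eq_append refl eq[symmetric])
      then show ?thesis by (simp add: word_inv_Cons)
    qed
    ultimately have "clen w \<le> length e"
      using clen_le_conj[of w "[bar x] @ h"] rlen_le[of e] by (metis order_trans)
    moreover have "clen w = length c" using h by (simp only: c_def)
    then have "clen w = length e + 2" by (simp add: e)
    ultimately show False by simp
  qed
  moreover have "length c = clen w" using h by (simp only: c_def)
  ultimately show thesis using eq by (rule that)
qed

lemma int_archimedean:
  fixes a b K :: int
  assumes "\<And>n. int n * a \<le> int n * b + K"
  shows "a \<le> b"
proof (rule ccontr)
  assume "\<not> a \<le> b"
  then have "int n * (b + 1) \<le> int n * a" for n by (intro mult_left_mono) auto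
  then have "int n * b + int n \<le> int n * b + K" for n
    using assms[of n] by (metis distrib_left mult.right_neutral order_trans)
  then have "int n \<le> K" for n by simp
  from this[of "nat K + 1"] show False by linarith
qed

lemma rlen_conj_le: "rlen (h @ w @ word_inv h) \<le> rlen w + 2 * length h"
  using rlen_append[of h "w @ word_inv h"] rlen_append[of w "word_inv h"] rlen_le[of h]
  by simp

text \<open>
  The cyclic length is the growth rate of the powers of \<open>w\<close>, up to a bounded error: the powers of the
  cyclically reduced core multiply without cancellation, and conjugation costs a constant.
  This turns each statement on lengths of linear words that is correct up to a constant into
  an exact statement on cyclic lengths, and cyclic words need not be handled directly.
\<close>

lemma rlen_wpow_bounds:
  "\<exists>K. \<forall>n. \<bar>int (rlen (wpow n w)) - int n * int (clen w)\<bar> \<le> K"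
proof -
  obtain h c where c: "c \<in> C2" "length c = clen w" "c \<simeq> h @ w @ word_inv h"
    by (rule cyclic_core)
  have "\<bar>int (rlen (wpow n w)) - int n * int (clen w)\<bar> \<le> 2 * int (length h)" for n
  proof -
    have 1: "wpow n c \<simeq> h @ wpow n w @ word_inv h"
      using wpow_cong[OF c(3), of n] wpow_conj[of n h w] by simp
    have "word_inv h @ wpow n c @ word_inv (word_inv h)
        \<simeq> word_inv h @ (h @ wpow n w @ word_inv h) @ word_inv (word_inv h)"
      by (intro free_eq_append refl 1)
    also have "\<dots> = reduce (word_inv h @ h @ (wpow n w @ word_inv h @ h))" by simp
    also have "\<dots> = reduce (wpow n w @ (word_inv h @ h))" by (rule cancel_inv_left)
    also have "\<dots> = reduce (wpow n w @ [])" by (intro free_eq_append refl inv_append_self)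
    finally have 2: "rlen (wpow n w) \<le> rlen (wpow n c) + 2 * length h"
      using rlen_conj_le[of "word_inv h" "wpow n c"] by simp
    have 3: "rlen (wpow n c) \<le> rlen (wpow n w) + 2 * length h"
      using rlen_conj_le[of h "wpow n w"] 1 by simp
    have "int (rlen (wpow n c)) = int n * int (clen w)"
      using rlen_wpow_C2[OF c(1)] c(2) by simp
    with 2 3 show ?thesis by linarith
  qed
  then show ?thesis by blast
qed

text \<open>
  Two affine functions of \<open>n\<close> at bounded distance have the same slope.
\<close>

lemma clen_eqI:
  assumes "\<And>n. \<bar>int (rlen (wpow n w)) - int n * c\<bar> \<le> K"
  shows "int (clen w) = c"
proof -
  obtain K' where K': "\<forall>n. \<bar>int (rlen (wpow n w)) - int n * int (clen w)\<bar> \<le> K'"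
    using rlen_wpow_bounds[of w] ..
  have "int n * int (clen w) \<le> int n * c + (K + K')" for n
    using assms[of n] spec[OF K', of n] by linarith
  moreover have "int n * c \<le> int n * int (clen w) + (K + K')" for n
    using assms[of n] spec[OF K', of n] by linarith
  ultimately show ?thesis by (metis int_archimedean antisym)
qed

lemma clen_C2: assumes "w \<in> C2" shows "clen w = length w"
  using clen_eqI[of w "int (length w)" 0] rlen_wpow_C2[OF assms] by simp

text \<open>
  Dividing by \<open>n\<close> makes the additive constant disappear.
\<close>

lemma clen_transfer:
  assumes "\<And>n. 2 * rlen (wpow n u) \<le> rlen (wpow n v) + rlen (wpow n w) + k"
  shows "2 * clen u \<le> clen v + clen w"
proof -
  obtain K1 where K1: "\<forall>n. \<bar>int (rlen (wpow n u)) - int n * int (clen u)\<bar> \<le> K1"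
    using rlen_wpow_bounds[of u] ..
  obtain K2 where K2: "\<forall>n. \<bar>int (rlen (wpow n v)) - int n * int (clen v)\<bar> \<le> K2"
    using rlen_wpow_bounds[of v] ..
  obtain K3 where K3: "\<forall>n. \<bar>int (rlen (wpow n w)) - int n * int (clen w)\<bar> \<le> K3"
    using rlen_wpow_bounds[of w] ..
  have "int n * (2 * int (clen u)) \<le> int n * (int (clen v) + int (clen w))
          + (2 * K1 + K2 + K3 + int k)" for n
    using spec[OF K1, of n] spec[OF K2, of n] spec[OF K3, of n] assms[of n] by (simp add: algebra_simps)
  then have "2 * int (clen u) \<le> int (clen v) + int (clen w)" by (rule int_archimedean)
  then show ?thesis by simp
qed

lemma clen_map: assumes "signed s" shows "clen (map s w) = clen w"
proof -
  have le: "clen (map s w) \<le> clen w" if s: "signed s" for s w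
  proof -
    obtain h where h: "clen w = rlen (h @ w @ word_inv h)" by (rule clen_attained)
    have "rlen (map s (h @ w @ word_inv h)) = clen w"
      using reduce_map[OF s, of "h @ w @ word_inv h"] h by (metis length_map)
    moreover have "map s (h @ w @ word_inv h) = map s h @ map s w @ word_inv (map s h)"
      by (simp add: map_word_inv[OF s])
    ultimately show ?thesis using clen_le_conj[of "map s w" "map s h"] by metis
  qed
  obtain t where t: "signed t" "\<And>x. t (s x) = x" using signed_inv[OF assms] by metis
  have "map t (map s w) = w" by (simp add: t(2) o_def)
  then show ?thesis using le[OF assms, of w] le[OF t(1), of "map s w"] by simp
qed


section \<open>Sums over adjacent pairs of letters\<close>

fun pair_sum :: "(letter \<Rightarrow> letter \<Rightarrow> int) \<Rightarrow> letter list \<Rightarrow> int" where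
  "pair_sum c (x # y # w) = c x y + pair_sum c (y # w)"
| "pair_sum c [x] = 0"
| "pair_sum c [] = 0"

lemma pair_sum_Cons: "pair_sum c (x # w) = (if w = [] then 0 else c x (hd w)) + pair_sum c w"
  by (cases w) auto

lemma pair_sum_append:
  "u \<noteq> [] \<Longrightarrow> v \<noteq> [] \<Longrightarrow>
    pair_sum c (u @ v) = pair_sum c u + c (last u) (hd v) + pair_sum c v"
proof (induction u)
  case (Cons x u)
  then show ?case by (cases u; cases v) auto
qed simp

lemma pair_sum_map: "pair_sum c (map s w) = pair_sum (\<lambda>x y. c (s x) (s y)) w"
  by (induction c w rule: pair_sum.induct) auto

lemma pair_sum_cong:
  "reduced w \<Longrightarrow> (\<And>x y. y \<noteq> bar x \<Longrightarrow> c x y = d x y) \<Longrightarrow> pair_sum c w = pair_sum d w"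
  by (induction c w rule: pair_sum.induct) (auto simp: reduced_Cons_Cons)

lemma pair_sum_add: "pair_sum (\<lambda>x y. c x y + d x y) w = pair_sum c w + pair_sum d w"
  by (induction c w rule: pair_sum.induct) auto

text \<open>
  The sum over the transitions of the cyclic word, including the one from the last to the first letter.
\<close>

definition cyc_sum :: "(letter \<Rightarrow> letter \<Rightarrow> int) \<Rightarrow> letter list \<Rightarrow> int" where
  "cyc_sum c w = pair_sum c (w @ [hd w])"

lemma cyc_sum_add: "cyc_sum (\<lambda>x y. c x y + d x y) w = cyc_sum c w + cyc_sum d w"
  by (simp add: cyc_sum_def pair_sum_add)

lemma cyc_sum_cong:
  assumes "w \<in> C2" "w \<noteq> []" "\<And>x y. y \<noteq> bar x \<Longrightarrow> c x y = d x y"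
  shows "cyc_sum c w = cyc_sum d w"
proof -
  have "reduced (w @ [hd w])"
    using assms(1,2) by (simp add: C2_iff reduced_append last_neq_bar_hd_iff)
  then show ?thesis unfolding cyc_sum_def using assms(3) by (rule pair_sum_cong)
qed

lemma cyc_sum_fst:
  "w \<noteq> [] \<Longrightarrow> cyc_sum (\<lambda>x y. f x) w = sum_list (map f w)"
  and cyc_sum_snd:
  "w \<noteq> [] \<Longrightarrow> cyc_sum (\<lambda>x y. f y) w = sum_list (map f w)"
proof -
  have *: "pair_sum (\<lambda>x y. f x) (w @ [z]) = sum_list (map f w)
     \<and> (w \<noteq> [] \<longrightarrow> pair_sum (\<lambda>x y. f y) (w @ [z]) = sum_list (map f w) - f (hd w) + f z)" for w z
  proof (induction w)
    case (Cons x w)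
    then show ?case by (cases w) auto
  qed simp
  show "w \<noteq> [] \<Longrightarrow> cyc_sum (\<lambda>x y. f x) w = sum_list (map f w)"
    "w \<noteq> [] \<Longrightarrow> cyc_sum (\<lambda>x y. f y) w = sum_list (map f w)"
    using *[of w "hd w"] by (simp_all add: cyc_sum_def)
qed

text \<open>
  A power of \<open>w\<close> passes \<open>n\<close> times through the cyclic word, except for the closing transition.
\<close>

lemma pair_sum_wpow:
  assumes "w \<noteq> []"
  shows "pair_sum c (wpow (Suc n) w) = int (Suc n) * cyc_sum c w - c (last w) (hd w)"
proof (induction n)
  case 0
  show ?case using assms by (simp add: cyc_sum_def pair_sum_append)
next
  case (Suc n)
  have "wpow (Suc n) w \<noteq> []" "hd (wpow (Suc n) w) = hd w" using assms by auto
  moreover have "wpow (Suc (Suc n)) w = w @ wpow (Suc n) w" by simp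
  ultimately have "pair_sum c (wpow (Suc (Suc n)) w)
      = pair_sum c w + c (last w) (hd w) + pair_sum c (wpow (Suc n) w)"
    using pair_sum_append[OF assms, of "wpow (Suc n) w" c] by metis
  moreover have "cyc_sum c w = pair_sum c w + c (last w) (hd w)"
    using assms by (simp add: cyc_sum_def pair_sum_append)
  ultimately show ?case using Suc by (simp only: of_nat_Suc) (simp add: algebra_simps)
qed

section \<open>The effect of a transvection on length\<close>

text \<open>
  The reduced image of a reduced word under \<open>a \<mapsto> a b\<close>. Each occurrence of \<open>a b\<inverse>\<close> or
  \<open>b a\<inverse>\<close> cancels one pair of letters, and no cancellation propagates further.
\<close>

fun image_AB :: "letter list \<Rightarrow> letter list" where
  "image_AB [] = []"
| "image_AB (A # B_inv # w) = A # image_AB w"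
| "image_AB (A # w) = A # B # image_AB w"
| "image_AB (B # A_inv # w) = A_inv # image_AB w"
| "image_AB (B # w) = B # image_AB w"
| "image_AB (A_inv # w) = B_inv # A_inv # image_AB w"
| "image_AB (B_inv # w) = B_inv # image_AB w"

lemma transvection_AB:
  "transvection A B A = [A, B]" "transvection A B A_inv = [B_inv, A_inv]"
  "transvection A B B = [B]" "transvection A B B_inv = [B_inv]"
  by (simp_all add: transvection_def)

lemma image_AB_eq: "reduce (image_AB w) = reduce (subst (transvection A B) w)"
proof (induction w rule: image_AB.induct)
  case (2 w)
  then show ?case
    using cons_reduce_cancel[of "reduce (subst (transvection A B) w)" B]
    by (simp add: transvection_AB reduce_Cons)
next
  case (4 w)
  then show ?case
    using cons_reduce_cancel[of "cons_reduce A_inv (reduce (subst (transvection A B) w))" B]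
    by (simp add: transvection_AB reduce_Cons reduced_cons_reduce)
qed (simp_all add: transvection_AB reduce_Cons)

text \<open>
  Reducedness needs control of the first letter of the image, so the induction traces each possible
  first letter back to the beginning of \<open>w\<close>.
\<close>

lemma reduced_image_AB:
  "reduced w \<Longrightarrow> reduced (image_AB w) \<and> (w \<noteq> [] \<longrightarrow> image_AB w \<noteq> []
    \<and> (hd (image_AB w) = A \<longrightarrow> hd w = A) \<and> (hd (image_AB w) = B \<longrightarrow> hd w = B) \<and> (hd (image_AB w) = B_inv \<longrightarrow> hd w \<in> {A_inv, B_inv})
    \<and> (hd (image_AB w) = A_inv \<longrightarrow> hd w = B \<and> tl w \<noteq> [] \<and> hd (tl w) = A_inv))"
  by (induction w rule: image_AB.induct) (auto simp: reduced_Cons)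

lemma length_image_AB:
  "reduced w \<Longrightarrow> int (length (image_AB w)) =
    int (length w) + (\<Sum>z\<leftarrow>w. of_bool (z \<in> {A, A_inv}))
      - 2 * pair_sum (\<lambda>p q. of_bool (p = A \<and> q = B_inv \<or> p = B \<and> q = A_inv)) w"
proof (induction w rule: image_AB.induct)
  case (2 w)
  then show ?case by (cases w) (auto simp: reduced_Cons pair_sum_Cons)
next
  case (4 w)
  then show ?case by (cases w) (auto simp: reduced_Cons pair_sum_Cons)
qed (auto simp: reduced_Cons pair_sum_Cons)

text \<open>
  The transvection \<open>x \<mapsto> x y\<close> adds a letter for each \<open>x\<^sup>\<plusminus>\<close> and loses two for each
  \<open>x y\<inverse>\<close> or its inverse. The basis \<open>x, y\<close> is presented as the image of \<open>a, b\<close> under a signed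
  permutation.
\<close>

lemma rlen_transvection:
  assumes s: "signed s" and w: "reduced w"
  shows "int (rlen (subst (transvection (s A) (s B)) w)) =
    int (length w) + (\<Sum>z\<leftarrow>w. of_bool (z \<in> {s A, s A_inv}))
      - 2 * pair_sum (\<lambda>p q. of_bool (p = s A \<and> q = s B_inv \<or> p = s B \<and> q = s A_inv)) w"
proof -
  obtain t where t: "signed t" "\<And>x. t (s x) = x" "\<And>x. s (t x) = x"
    using signed_inv[OF s] by metis
  have tw: "reduced (map t w)" by (metis reduce_map reduce_reduced reduced_reduce t(1) w)
  have st: "map s (map t w) = w" by (simp add: t o_def)
  have eq: "t z = x \<longleftrightarrow> z = s x" for z x using t(2,3) by metis
  have "subst (transvection (s A) (s B)) w = map s (subst (transvection A B) (map t w))"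
    by (simp only: transvection_map[OF s] st)
  then have "rlen (subst (transvection (s A) (s B)) w) = rlen (subst (transvection A B) (map t w))"
    by (simp only: reduce_map[OF s] length_map)
  also have "\<dots> = length (image_AB (map t w))"
    using reduced_image_AB[OF tw] image_AB_eq[of "map t w"] by (metis reduce_reduced)
  finally show ?thesis
    by (simp add: length_image_AB[OF tw] pair_sum_map eq o_def)
qed

definition flipB :: "letter \<Rightarrow> letter" where
  "flipB x = (case x of A \<Rightarrow> A | B \<Rightarrow> B_inv | A_inv \<Rightarrow> A_inv | B_inv \<Rightarrow> B)"

definition swapAB :: "letter \<Rightarrow> letter" where
  "swapAB x = (case x of A \<Rightarrow> B | B \<Rightarrow> A | A_inv \<Rightarrow> B_inv | B_inv \<Rightarrow> A_inv)"

lemma signed_flipB: "signed flipB"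
proof (rule signed_if_inj)
  show "inj flipB" by (auto simp: inj_def flipB_def split: letter.splits)
  show "flipB (bar x) = bar (flipB x)" for x by (cases x) (auto simp: flipB_def)
qed

lemma signed_swapAB: "signed swapAB"
proof (rule signed_if_inj)
  show "inj swapAB" by (auto simp: inj_def swapAB_def split: letter.splits)
  show "swapAB (bar x) = bar (swapAB x)" for x by (cases x) (auto simp: swapAB_def)
qed

lemma rlen_subst_reduce: "inv_compat f \<Longrightarrow> rlen (subst f (reduce w)) = rlen (subst f w)"
  by (simp only: subst_reduce)

text \<open>
  Convexity in one direction: a letter \<open>a\<close> is charged for a cancellation at the letter after it,
  a letter \<open>a\<inverse>\<close> at the letter before it. Under \<open>a \<mapsto> a b\<close> and \<open>a \<mapsto> a b\<inverse>\<close> together, each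
  is charged at most once.
\<close>

lemma rlen_convex_same:
  "2 * rlen w \<le> rlen (subst (transvection A B) w) + rlen (subst (transvection A B_inv) w)"
proof -
  have ineq: "pair_sum (\<lambda>p q. of_bool (p = A \<and> q = B_inv \<or> p = B \<and> q = A_inv)) u
      + pair_sum (\<lambda>p q. of_bool (p = A \<and> q = B \<or> p = B_inv \<and> q = A_inv)) u
      \<le> (\<Sum>z\<leftarrow>u. of_bool (z \<in> {A, A_inv})) - of_bool (u \<noteq> [] \<and> hd u = A_inv)" for u
  proof (induction u rule: induct_list012)
    case (3 x y zs)
    then show ?case by (cases x; cases y) auto
  qed auto
  have nonneg: "a - of_bool b \<le> a" for a :: int and b by simp
  have red: "reduced (reduce w)" by simp
  show ?thesis
    using rlen_transvection[OF signed_id(1) red] rlen_transvection[OF signed_flipB red]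
      order_trans[OF ineq nonneg, of "reduce w"] rlen_subst_reduce[OF inv_compat_transvection, of A B w]
      rlen_subst_reduce[OF inv_compat_transvection, of A B_inv w]
    by (simp add: flipB_def split: if_splits)
qed

text \<open>
  Under \<open>b \<mapsto> b a\<close> and \<open>a \<mapsto> a b\<inverse>\<close> together, the cancellations are the transitions from
  \<open>a\<close> to \<open>b\<^sup>\<plusminus>\<close> and from \<open>b\<^sup>\<plusminus>\<close> to \<open>a\<inverse>\<close>. A maximal block of letters
  \<open>a\<close> is left by such a transition but not entered by one, and a maximal block of letters
  \<open>a\<inverse>\<close> is entered by one but not left by one. So they make up at most half of all transitions, up to
  an effect of the two ends of the word.
\<close>

lemma rlen_convex_mixed:
  "2 * rlen w \<le> rlen (subst (transvection B A) w) + rlen (subst (transvection A B_inv) w) + 1"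
proof -
  \<comment> \<open>The potential accounts for a block of \<open>a\<close> or \<open>a\<inverse>\<close> that is cut off at the left end of a suffix.\<close>
  define pot :: "letter \<Rightarrow> int" where "pot z = of_bool (z = A_inv) - of_bool (z = A)" for z
  have ineq: "reduced u \<Longrightarrow> (if u = [] then 0 else pot (hd u)) \<le>
      (\<Sum>z\<leftarrow>u. of_bool (z \<in> {A, A_inv})) + (\<Sum>z\<leftarrow>u. of_bool (z \<in> {B, B_inv}))
      - 2 * pair_sum (\<lambda>p q. of_bool (p = B \<and> q = A_inv \<or> p = A \<and> q = B_inv)) u
      - 2 * pair_sum (\<lambda>p q. of_bool (p = A \<and> q = B \<or> p = B_inv \<and> q = A_inv)) u" for u
  proof (induction u rule: induct_list012)
    case (2 x)
    then show ?case by (cases x) (auto simp: pot_def)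
  next
    case (3 x y zs)
    then show ?case by (cases x; cases y) (auto simp: pot_def reduced_Cons_Cons)
  qed auto
  have pot: "- 1 \<le> (if u = [] then 0 else pot (hd u))" for u by (auto simp: pot_def)
  have red: "reduced (reduce w)" by simp
  show ?thesis
    using rlen_transvection[OF signed_swapAB red] rlen_transvection[OF signed_flipB red]
      ineq[OF red] pot[of "reduce w"] rlen_subst_reduce[OF inv_compat_transvection, of B A w]
      rlen_subst_reduce[OF inv_compat_transvection, of A B_inv w]
    by (simp add: flipB_def swapAB_def)
qed

lemma clen_convex_same:
  "2 * clen w \<le> clen (subst (transvection A B) w) + clen (subst (transvection A B_inv) w)"
  by (rule clen_transfer[where k = 0]) (use rlen_convex_same in \<open>simp add: subst_wpow[symmetric]\<close>)

lemma clen_convex_mixed: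
  "2 * clen w \<le> clen (subst (transvection B A) w) + clen (subst (transvection A B_inv) w)"
  by (rule clen_transfer[where k = 1]) (use rlen_convex_mixed in \<open>simp add: subst_wpow[symmetric]\<close>)

lemma clen_transvection_map: assumes "signed s"
  shows "clen (subst (transvection (s x) (s y)) (map s w)) = clen (subst (transvection x y) w)"
  by (metis assms clen_map transvection_map)

text \<open>
  A word is uphill if neither positive transvection shortens it cyclically. By convexity this
  property survives a positive transvection: going back one step does not lengthen the word, hence
  going on does not shorten it.
\<close>

definition uphill :: "letter list \<Rightarrow> bool" where
  "uphill w \<longleftrightarrow> clen w \<le> clen (subst (transvection A B) w) \<and> clen w \<le> clen (subst (transvection B A) w)"

lemma uphill_swap: "uphill (map swapAB w) \<longleftrightarrow> uphill w"
  using clen_transvection_map[OF signed_swapAB, of A B w]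
    clen_transvection_map[OF signed_swapAB, of B A w] clen_map[OF signed_swapAB, of w]
  by (auto simp: uphill_def swapAB_def)

lemma uphill_step_A: assumes "uphill w" shows "uphill (subst (transvection A B) w)"
proof -
  let ?v = "subst (transvection A B) w"
  have "subst (transvection A B_inv) ?v \<simeq> w"
    using transvection_cancel[of B_inv A w] by simp
  then have "clen (subst (transvection A B_inv) ?v) = clen w" by (rule clen_cong)
  then show ?thesis
    using assms clen_convex_same[of ?v] clen_convex_mixed[of ?v] unfolding uphill_def by linarith
qed

lemma uphill_step_B: assumes "uphill w" shows "uphill (subst (transvection B A) w)"
proof -
  have "uphill (subst (transvection A B) (map swapAB w))"
    using assms by (intro uphill_step_A) (simp add: uphill_swap)
  moreover have "subst (transvection A B) (map swapAB w) = map swapAB (subst (transvection B A) w)"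
    using transvection_map[OF signed_swapAB, of B A w] by (simp add: swapAB_def)
  ultimately show ?thesis using uphill_swap by metis
qed


section \<open>Subword counts\<close>

text \<open>
  Apply \<open>rlen_transvection\<close> to the powers of \<open>w\<close> and compare slopes.
\<close>

lemma clen_transvection_C2:
  assumes s: "signed s" and w: "w \<in> C2" "w \<noteq> []"
  shows "int (clen (subst (transvection (s A) (s B)) w)) =
    int (length w) + (\<Sum>z\<leftarrow>w. of_bool (z \<in> {s A, s A_inv}))
      - 2 * cyc_sum (\<lambda>p q. of_bool (p = s A \<and> q = s B_inv \<or> p = s B \<and> q = s A_inv)) w"
    (is "_ = ?l + ?a - 2 * cyc_sum ?c w")
proof (rule clen_eqI[where K = 2])
  fix n
  have sum_list_wpow: "(\<Sum>z\<leftarrow>wpow n w. f z) = int n * (\<Sum>z\<leftarrow>w. f z)" for f :: "letter \<Rightarrow> int"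
    by (induction n) (auto simp: algebra_simps)
  show "\<bar>int (rlen (wpow n (subst (transvection (s A) (s B)) w)))
      - int n * (?l + ?a - 2 * cyc_sum ?c w)\<bar> \<le> 2"
  proof (cases n)
    case (Suc m)
    have p: "pair_sum ?c (wpow n w) = int n * cyc_sum ?c w - ?c (last w) (hd w)"
      unfolding Suc by (rule pair_sum_wpow[OF w(2)])
    have "int (rlen (wpow n (subst (transvection (s A) (s B)) w)))
        = int (length (wpow n w)) + (\<Sum>z\<leftarrow>wpow n w. of_bool (z \<in> {s A, s A_inv}))
          - 2 * pair_sum ?c (wpow n w)"
      using rlen_transvection[OF s reduced_wpow[OF w(1)], of n] by (simp only: subst_wpow)
    also have "\<dots> = int n * (?l + ?a - 2 * cyc_sum ?c w) + 2 * ?c (last w) (hd w)"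
      unfolding p sum_list_wpow length_wpow by (simp add: algebra_simps)
    finally show ?thesis by simp
  qed simp
qed

lemma card_occurrences:
  "int (card {i. i + 2 \<le> length u \<and> take 2 (drop i u) = [x, y]})
    = pair_sum (\<lambda>p q. of_bool (p = x \<and> q = y)) u"
proof (induction u rule: induct_list012)
  case (3 p q u)
  let ?S = "\<lambda>u. {i. i + 2 \<le> length u \<and> take 2 (drop i u) = [x, y]}"
  have "?S (p # q # u) = (if p = x \<and> q = y then {0} else {}) \<union> Suc ` ?S (q # u)"
  proof (rule Set.set_eqI)
    fix i show "i \<in> ?S (p # q # u) \<longleftrightarrow> i \<in> (if p = x \<and> q = y then {0} else {}) \<union> Suc ` ?S (q # u)"
      by (cases i) (auto simp: numeral_2_eq_2)
  qed
  moreover have "finite (?S (q # u))" by (rule finite_subset[of _ "{..length (q # u)}"]) auto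
  ultimately have "int (card (?S (p # q # u)))
      = of_bool (p = x \<and> q = y) + int (card (?S (q # u)))"
    by (auto simp: card_image)
  with 3 show ?case by simp
qed auto

lemma occ_eq_cyc_sum:
  assumes "2 \<le> length w"
  shows "int (occ [x, y] w) = cyc_sum (\<lambda>p q. of_bool (p = x \<and> q = y)) w"
proof -
  have "take (Suc 0) w = [hd w]" using assms by (cases w) auto
  then show ?thesis
    using assms card_occurrences[of "w @ [hd w]" x y]
    by (simp add: occ_def cyc_sum_def Let_def numeral_2_eq_2)
qed

lemma count_pm_eq_cyc_sum:
  assumes "2 \<le> length w"
  shows "int (count_pm [x, y] w) =
    cyc_sum (\<lambda>p q. of_bool (p = x \<and> q = y) + of_bool (p = bar y \<and> q = bar x)) w"
  using assms by (simp add: count_pm_def word_inv_def occ_eq_cyc_sum cyc_sum_add)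


section \<open>Positive normal forms\<close>

text \<open>
  \<open>positive bs\<close> is the product of the transvections \<open>a \<mapsto> a b\<close> and \<open>b \<mapsto> b a\<close> coded by \<open>bs\<close>,
  the last one being applied first.
\<close>

definition positive_step :: "bool \<Rightarrow> letter list \<Rightarrow> letter list" where
  "positive_step b = subst (if b then transvection A B else transvection B A)"

abbreviation positive :: "bool list \<Rightarrow> letter list \<Rightarrow> letter list" where
  "positive bs w \<equiv> foldr positive_step bs w"

lemma positive_append: "positive bs (u @ v) = positive bs u @ positive bs v"
  by (induction bs) (auto simp: positive_step_def)

lemma positive_word_inv: "positive bs (word_inv u) = word_inv (positive bs u)"
  by (induction bs) (simp_all add: positive_step_def subst_word_inv inv_compat_transvection)

lemma positive_cong: "u \<simeq> v \<Longrightarrow> positive bs u \<simeq> positive bs v"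
proof (induction bs)
  case (Cons b bs)
  have "inv_compat (if b then transvection A B else transvection B A)"
    by (simp add: inv_compat_transvection)
  from subst_cong[OF this Cons.IH[OF Cons.prems]] show ?case
    by (simp add: positive_step_def)
qed simp

lemma positive_swap: "positive bs (map swapAB w) = map swapAB (positive (map Not bs) w)"
proof (induction bs)
  case (Cons b bs)
  have "positive_step b (map swapAB u) = map swapAB (positive_step (\<not> b) u)" for u
    using transvection_map[OF signed_swapAB, of A B u] transvection_map[OF signed_swapAB, of B A u]
    by (simp add: positive_step_def swapAB_def)
  with Cons show ?case by simp
qed simp

text \<open>
  The transvection applied first does not shorten the word and keeps it uphill.
\<close>

lemma clen_positive: "uphill w \<Longrightarrow> clen w \<le> clen (positive bs w)"
proof (induction bs arbitrary: w rule: rev_induct)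
  case (snoc b bs)
  have "uphill (positive_step b w)" "clen w \<le> clen (positive_step b w)"
    using snoc.prems uphill_step_A uphill_step_B by (auto simp: positive_step_def uphill_def)
  with snoc.IH[of "positive_step b w"] show ?case by simp
qed simp

text \<open>
  Positive products up to signed permutations on either side and an inner automorphism. Geometrically,
  the bases up to conjugation and signs form the edges of the Farey triangulation, and a normal form
  is a path without backtracking in the dual tree.
\<close>

definition normal_form :: "(letter list \<Rightarrow> letter list) \<Rightarrow> bool" where
  "normal_form F \<longleftrightarrow> (\<exists>h s bs t. signed s \<and> signed t
     \<and> (\<forall>w. F w \<simeq> h @ map s (positive bs (map t w)) @ word_inv h))"

lemma normal_formI:
  "signed s \<Longrightarrow> signed t \<Longrightarrow> (\<And>w. F w \<simeq> h @ map s (positive bs (map t w)) @ word_inv h)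
    \<Longrightarrow> normal_form F"
  unfolding normal_form_def by blast

lemma normal_form_positive: "normal_form (positive bs)"
  by (rule normal_formI[OF signed_id(2) signed_id(2), where h = "[]" and bs = bs]) simp

lemma normal_form_conj:
  assumes "normal_form F" "\<And>w. G w \<simeq> k @ F w @ word_inv k"
  shows "normal_form G"
proof -
  obtain h s bs t where st: "signed s" "signed t"
    and F: "\<And>w. F w \<simeq> h @ map s (positive bs (map t w)) @ word_inv h"
    using assms(1) unfolding normal_form_def by blast
  have "G w \<simeq> (k @ h) @ map s (positive bs (map t w)) @ word_inv (k @ h)" for w
  proof -
    have "k @ F w @ word_inv k \<simeq> k @ (h @ map s (positive bs (map t w)) @ word_inv h) @ word_inv k"
      by (intro free_eq_append refl F)
    then show ?thesis using assms(2)[of w] by simp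
  qed
  with st show ?thesis by (rule normal_formI)
qed

lemma normal_form_cong: "normal_form F \<Longrightarrow> (\<And>w. G w \<simeq> F w) \<Longrightarrow> normal_form G"
  by (rule normal_form_conj[where k = "[]"]) simp_all

lemma normal_form_map_right:
  assumes "normal_form F" "signed r" shows "normal_form (\<lambda>w. F (map r w))"
proof -
  obtain h s bs t where st: "signed s" "signed t"
    and F: "\<And>w. F w \<simeq> h @ map s (positive bs (map t w)) @ word_inv h"
    using assms(1) unfolding normal_form_def by blast
  have "F (map r w) \<simeq> h @ map s (positive bs (map (\<lambda>x. t (r x)) w)) @ word_inv h" for w
    using F[of "map r w"] by (simp add: o_def)
  with st(1) signed_comp[OF st(2) assms(2)] show ?thesis by (rule normal_formI)
qed

lemma normal_form_map_left:
  assumes "normal_form F" "signed r" shows "normal_form (\<lambda>w. map r (F w))"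
proof -
  obtain h s bs t where st: "signed s" "signed t"
    and F: "\<And>w. F w \<simeq> h @ map s (positive bs (map t w)) @ word_inv h"
    using assms(1) unfolding normal_form_def by blast
  have "map r (F w) \<simeq> map r h @ map (\<lambda>x. r (s x)) (positive bs (map t w)) @ word_inv (map r h)" for w
    using map_cong_free[OF assms(2) F, of w] by (simp add: map_word_inv[OF assms(2)] o_def)
  with signed_comp[OF assms(2) st(1)] st(2) show ?thesis by (rule normal_formI)
qed

text \<open>
  The signed permutation that relates the two edges of a Farey triangle
  reached from the third one.
\<close>

definition turn :: "letter \<Rightarrow> letter" where
  "turn x = (case x of A \<Rightarrow> B_inv | B \<Rightarrow> A | A_inv \<Rightarrow> B | B_inv \<Rightarrow> A_inv)"

lemma signed_turn: "signed turn"
proof (rule signed_if_inj)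
  show "inj turn" by (auto simp: inj_def turn_def split: letter.splits)
  show "turn (bar x) = bar (turn x)" for x by (cases x) (auto simp: turn_def)
qed

text \<open>
  With \<open>L\<close> for \<open>a \<mapsto> a b\<close> and \<open>R\<close> for \<open>b \<mapsto> b a\<close>, the product \<open>R L\<inverse>\<close> is \<open>L\<close> up to signs and
  conjugation: moving from one side of a Farey triangle to another one does not leave the triangle.
\<close>

lemma sibling_step:
  "subst (transvection B A) (subst (transvection A B_inv) w)
    \<simeq> [B] @ subst (transvection A B) (map turn w) @ word_inv [B]"
proof -
  let ?f = "\<lambda>x. subst (transvection B A) (transvection A B_inv x)"
  let ?g = "\<lambda>x. subst (transvection A B) [turn x]"
  have tg: "inv_compat ?g"
    by (intro inv_compat_comp[where g = "\<lambda>x. [turn x]"] inv_compat_transvection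
        inv_compat_letters signed_turn)
  have "subst ?f w \<simeq> subst (\<lambda>x. [B] @ ?g x @ word_inv [B]) w"
    by (intro subst_eqI inv_compat_comp inv_compat_transvection inv_compat_conj tg)
      (simp_all add: transvection_def turn_def reduce_def)
  also have "\<dots> = reduce ([B] @ subst ?g w @ word_inv [B])" by (rule subst_conj)
  finally show ?thesis by (simp add: subst_subst o_def)
qed

text \<open>
  The inverse transvection \<open>a \<mapsto> a b\<inverse>\<close> cancels against the transvection \<open>a \<mapsto> a b\<close>,
  replaces \<open>b \<mapsto> b a\<close> by its sibling, and, if nothing precedes it, is itself a positive transvection up to
  signs.
\<close>

lemma normal_form_positive_A_Binv:
  "normal_form (\<lambda>w. positive bs (subst (transvection A B_inv) w))"
proof (cases bs rule: rev_cases)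
  case Nil
  have flip: "flipB (flipB x) = x" "flipB A = A" "flipB B = B_inv" for x
    by (cases x) (simp_all add: flipB_def)
  have "map flipB (map flipB w) = w" for w by (simp add: o_def flip)
  then have "subst (transvection A B_inv) w = map flipB (positive [True] (map flipB w))" for w
    using transvection_map[OF signed_flipB, of A B "map flipB w"]
    by (simp only: positive_step_def flip foldr.simps o_apply id_apply if_True)
  then show ?thesis
    using normal_form_map_left[OF normal_form_map_right[OF normal_form_positive[of "[True]"] signed_flipB] signed_flipB]
    by (simp add: Nil)
next
  case (snoc bs' b)
  show ?thesis
  proof (cases b)
    case True
    have "positive bs (subst (transvection A B_inv) w) \<simeq> positive bs' w" for w
      using positive_cong[OF transvection_cancel[of B A w], of bs'] True snoc
      by (simp add: positive_step_def)
    with normal_form_positive show ?thesis by (rule normal_form_cong)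
  next
    case False
    have "positive bs (subst (transvection A B_inv) w)
        \<simeq> positive bs' [B] @ positive (bs' @ [True]) (map turn w) @ word_inv (positive bs' [B])" for w
      using positive_cong[OF sibling_step[of w], of bs'] False snoc
      by (simp only: positive_append positive_word_inv foldr_append)
        (simp add: positive_step_def)
    with normal_form_map_right[OF normal_form_positive signed_turn] show ?thesis
      by (rule normal_form_conj)
  qed
qed

lemma normal_form_swap:
  assumes "\<And>bs. normal_form (\<lambda>w. positive bs (subst (transvection (swapAB x) (swapAB y)) w))"
  shows "normal_form (\<lambda>w. positive bs (subst (transvection x y) w))"
proof -
  have swap2: "map swapAB (map swapAB w) = w" for w
    by (auto simp: swapAB_def intro!: map_idI split: letter.splits)
  have "positive bs (subst (transvection x y) w) = map swapAB
      (positive (map Not bs) (subst (transvection (swapAB x) (swapAB y)) (map swapAB w)))" for w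
    by (simp only: positive_swap[symmetric] transvection_map[OF signed_swapAB, symmetric] swap2)
  then show ?thesis
    using normal_form_map_left[OF normal_form_map_right[OF assms signed_swapAB] signed_swapAB]
    by simp
qed

lemma normal_form_positive_transvection:
  assumes "y \<notin> {x, bar x}"
  shows "normal_form (\<lambda>w. positive bs (subst (transvection x y) w))"
proof -
  have AB: "normal_form (\<lambda>w. positive bs (subst (transvection A y) w))" if "y \<in> {B, B_inv}" for y bs
    using that normal_form_positive_A_Binv[of bs] normal_form_positive[of "bs @ [True]"]
    by (auto simp: positive_step_def)
  have BA: "normal_form (\<lambda>w. positive bs (subst (transvection B y) w))" if "y \<in> {A, A_inv}" for y bs
    by (rule normal_form_swap) (use that AB in \<open>auto simp: swapAB_def\<close>)
  have inv: "normal_form (\<lambda>w. positive bs (subst (transvection (bar x) y) w))"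
    if "y \<notin> {x, bar x}" and F: "normal_form (\<lambda>w. positive bs (subst (transvection x (bar y)) w))" for x y bs
  proof -
    have "positive bs (subst (transvection (bar x) y) w)
      \<simeq> positive bs [bar y] @ positive bs (subst (transvection x (bar y)) w) @ word_inv (positive bs [bar y])" for w
      using positive_cong[OF transvection_bar[OF that(1)], of bs w]
      by (simp only: positive_append positive_word_inv[symmetric]) simp
    with F show ?thesis by (rule normal_form_conj)
  qed
  have ABi: "normal_form (\<lambda>w. positive bs (subst (transvection A_inv y) w))" if "y \<in> {B, B_inv}" for y bs
    using that inv[of y A bs] AB[of "bar y" bs] by auto
  have BAi: "normal_form (\<lambda>w. positive bs (subst (transvection B_inv y) w))" if "y \<in> {A, A_inv}" for y bs
    using that inv[of y B bs] BA[of "bar y" bs] by auto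
  have ys: "y \<in> {A, B, A_inv, B_inv}" by (cases y) auto
  show ?thesis
    using assms ys AB[of y bs] BA[of y bs] ABi[of y bs] BAi[of y bs] by (cases x) auto
qed

text \<open>
  Normal forms are closed under composition with transvections: move the transvection past the
  signed permutation and absorb it into the positive product.
\<close>

lemma normal_form_transvection:
  assumes "normal_form F" "y \<notin> {x, bar x}"
  shows "normal_form (\<lambda>w. F (subst (transvection x y) w))"
proof -
  obtain h s bs t where st: "signed s" "signed t"
    and F: "\<And>w. F w \<simeq> h @ map s (positive bs (map t w)) @ word_inv h"
    using assms(1) unfolding normal_form_def by blast
  have "t y \<notin> {t x, bar (t x)}"
    using assms(2) signed_inj[OF st(2)] signed_bar[OF st(2)] by (metis insert_iff singletonD)
  then have "normal_form (\<lambda>w. positive bs (subst (transvection (t x) (t y)) w))"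
    by (rule normal_form_positive_transvection)
  from normal_form_map_left[OF normal_form_map_right[OF this st(2)] st(1)]
  show ?thesis
    by (rule normal_form_conj[where k = h]) (simp add: F transvection_map[OF st(2)])
qed


section \<open>Cancellation\<close>

lemma cancellation:
  assumes "reduced g" "reduced h"
  obtains s t m where "g = s @ t" "h = word_inv t @ m" "reduced (s @ m)"
proof -
  have "\<exists>s t m. g = s @ t \<and> h = word_inv t @ m \<and> reduced (s @ m)"
    using assms
  proof (induction g arbitrary: h rule: rev_induct)
    case Nil
    then show ?case by (intro exI[of _ "[]"] exI[of _ h]) simp
  next
    case (snoc x g)
    show ?case
    proof (cases "h \<noteq> [] \<and> hd h = bar x")
      case True
      then obtain h' where h: "h = bar x # h'" by (cases h) auto
      with snoc.prems have "reduced g" "reduced h'" by (auto simp: reduced_append reduced_Cons)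
      from snoc.IH[OF this] obtain s t m where
        "g = s @ t" "h' = word_inv t @ m" "reduced (s @ m)" by blast
      then have "g @ [x] = s @ (t @ [x]) \<and> h = word_inv (t @ [x]) @ m \<and> reduced (s @ m)"
        using h by simp
      then show ?thesis by (intro exI)
    next
      case False
      then have "reduced ((g @ [x]) @ h)" using snoc.prems by (auto simp: reduced_append reduced_Cons)
      then show ?thesis by (intro exI[of _ "g @ [x]"] exI[of _ "[]"] exI[of _ h]) simp
    qed
  qed
  then show thesis using that by blast
qed

lemma product_reduce:
  assumes "g = s @ t" "h = word_inv t @ m" "reduced (s @ m)"
  shows "reduce (g @ h) = s @ m"
proof -
  have "g @ h \<simeq> s @ m"
    using free_eq_append[OF refl cancel_left_inv[of t m], of s] assms by simp
  then show ?thesis using reduce_reduced[OF assms(3)] by simp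
qed

lemma nth_word_inv: "i < length t \<Longrightarrow> word_inv t ! i = bar (t ! (length t - 1 - i))"
  by (simp add: word_inv_def rev_nth)

text \<open>
  In a product \<open>g g\<close> less than half of \<open>g\<close> cancels. Otherwise the letters in the middle of \<open>g\<close> would be
  mutually inverse neighbours, or a letter would be its own inverse.
\<close>

lemma self_cancel:
  assumes "reduced g" "g \<noteq> []" "g = s @ t" "g = word_inv t @ m"
  shows "2 * length t < length g"
proof (rule ccontr)
  assume len: "\<not> 2 * length t < length g"
  define n where "n = length g"
  have n: "0 < n" using assms(2) by (simp add: n_def)
  have ns: "n = length s + length t" using assms(3) by (simp add: n_def)
  have sym: "g ! i = bar (g ! (n - 1 - i))" if "i < length t" for i
  proof -
    have "g ! i = bar (t ! (length t - 1 - i))"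
      using that assms(4) by (simp add: nth_append nth_word_inv)
    moreover have "g ! (n - 1 - i) = t ! (length t - 1 - i)"
    proof -
      have "n - 1 - i = length s + (length t - 1 - i)" using that ns by linarith
      then show ?thesis by (simp only: assms(3) nth_append_length_plus)
    qed
    ultimately show ?thesis by simp
  qed
  \<comment> \<open>The middle letter, or the left one of the two middle letters.\<close>
  define i where "i = (n - 1) div 2"
  have i: "i < length t" using len n unfolding i_def n_def by linarith
  show False
  proof (cases "even n")
    case True
    then obtain k where "n = 2 * k" by (rule evenE)
    with n obtain j where "n = 2 * Suc j" by (cases k) auto
    then have i1: "n - 1 - i = Suc i" "Suc i < n" by (simp_all add: i_def)
    have "g ! Suc i \<noteq> bar (g ! i)"
      using assms(1) i1(2) unfolding reduced_def successively_conv_nth n_def by blast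
    then show False using sym[OF i] i1(1) by simp
  next
    case False
    then obtain j where "n = 2 * j + 1" by (rule oddE)
    then have "n - 1 - i = i" by (simp add: i_def)
    then show False using sym[OF i] by simp
  qed
qed

text \<open>
  The length property of Nielsen reduced systems. \<open>T x y\<close> is the part cancelled in the product of
  \<open>F x\<close> and \<open>F y\<close>. If the two cancellations next to each factor leave some of its letters, then each
  factor contributes at least one letter to the reduced product. The induction has to remember
  that the first factor survives up to its cancellation with the second, because a further factor on the
  left cancels against this part.
\<close>

lemma Nielsen_reduced_length:
  assumes T: "\<And>x y. y \<noteq> bar x \<Longrightarrow>
      \<exists>s m. F x = s @ T x y \<and> F y = word_inv (T x y) @ m \<and> reduced (s @ m)"
    and red: "\<And>x. reduced (F x)"
    and lt: "\<And>x y z. y \<noteq> bar x \<Longrightarrow> z \<noteq> bar y \<Longrightarrow> length (T x y) + length (T y z) < length (F y)"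
    and lt1: "\<And>x y. y \<noteq> bar x \<Longrightarrow> length (T x y) < length (F y)"
    and w: "reduced (y # w)"
  shows "\<exists>r. reduce (subst F (y # w)) =
      take (length (F y) - (if w = [] then 0 else length (T y (hd w)))) (F y) @ r
      \<and> length w \<le> length r"
  using w
proof (induction w arbitrary: y)
  case Nil
  show ?case by (simp add: reduce_reduced[OF red])
next
  case (Cons z w)
  have zy: "z \<noteq> bar y" and zw: "reduced (z # w)" using Cons.prems by (auto simp: reduced_Cons)
  define d where "d = (if w = [] then 0 else length (T z (hd w)))"
  define t where "t = T y z"
  obtain r where r: "reduce (subst F (z # w)) = take (length (F z) - d) (F z) @ r"
    "length w \<le> length r" using Cons.IH[OF zw] unfolding d_def by blast
  have dt: "length t + d < length (F z)"
  proof (cases w)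
    case Nil
    then show ?thesis using lt1[OF zy] by (simp add: d_def t_def)
  next
    case (Cons u w')
    then show ?thesis using lt[OF zy, of u] zw by (simp add: d_def t_def reduced_Cons_Cons)
  qed
  obtain s m where Fy: "F y = s @ t" and Fz: "F z = word_inv t @ m" and sm: "reduced (s @ m)"
    using T[OF zy] unfolding t_def by blast
  define p where "p = take (length (F z) - d - length t) m"
  have p: "p \<noteq> []" using dt Fz by (auto simp: p_def)
  have "take (length (F z) - d) (F z) = word_inv t @ p"
    using dt by (simp add: Fz p_def)
  then have r': "reduce (subst F (z # w)) = word_inv t @ p @ r" using r(1) by simp
  have "reduced (word_inv t @ p @ r)" by (metis r' reduced_reduce)
  then have pr: "reduced (p @ r)" by (simp add: reduced_append)
  have "s @ m = (s @ p) @ drop (length (F z) - d - length t) m" by (simp add: p_def)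
  then have sp: "reduced (s @ p)" using sm by (metis reduced_append)
  have spr: "reduced (s @ p @ r)" using sp pr p by (auto simp: reduced_append)
  have "subst F (y # z # w) \<simeq> (s @ t) @ (word_inv t @ p @ r)"
  proof -
    have "F y @ subst F (z # w) \<simeq> F y @ (word_inv t @ p @ r)"
      by (intro free_eq_append refl) (metis r' reduce_reduce)
    then show ?thesis by (simp add: Fy)
  qed
  also have "\<dots> = s @ p @ r" by (rule product_reduce[OF refl refl spr])
  finally have "reduce (subst F (y # z # w)) = s @ p @ r" .
  moreover have "take (length (F y) - length t) (F y) = s" by (simp add: Fy)
  moreover have "length (z # w) \<le> length (p @ r)" using p r(2) by (cases p) auto
  ultimately show ?case by (simp add: t_def)
qed


section \<open>Automorphisms\<close>

text \<open>
  Automorphisms as substitutions, with an inverse up to free reduction.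
\<close>

definition invertible :: "(letter \<Rightarrow> letter list) \<Rightarrow> bool" where
  "invertible f \<longleftrightarrow> inv_compat f \<and> (\<exists>g. inv_compat g
     \<and> (\<forall>w. subst f (subst g w) \<simeq> w) \<and> (\<forall>w. subst g (subst f w) \<simeq> w))"

lemma invertible_inv_compat: "invertible f \<Longrightarrow> inv_compat f"
  by (simp add: invertible_def)

lemma invertible_comp:
  assumes "invertible f" "invertible g" shows "invertible (\<lambda>x. subst f (g x))"
proof -
  obtain f' where f': "inv_compat f'" "\<And>w. subst f (subst f' w) \<simeq> w" "\<And>w. subst f' (subst f w) \<simeq> w"
    using assms(1) unfolding invertible_def by blast
  obtain g' where g': "inv_compat g'" "\<And>w. subst g (subst g' w) \<simeq> w" "\<And>w. subst g' (subst g w) \<simeq> w"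
    using assms(2) unfolding invertible_def by blast
  note fc = invertible_inv_compat[OF assms(1)] and gc = invertible_inv_compat[OF assms(2)]
  have "subst f (subst g (subst g' (subst f' w))) \<simeq> w" for w
    using subst_cong[OF fc g'(2)[of "subst f' w"]] f'(2)[of w] by (rule trans)
  moreover have "subst g' (subst f' (subst f (subst g w))) \<simeq> w" for w
    using subst_cong[OF g'(1) f'(3)[of "subst g w"]] g'(3)[of w] by (rule trans)
  ultimately show ?thesis
    unfolding invertible_def
    by (intro conjI exI[of _ "\<lambda>x. subst g' (f' x)"] inv_compat_comp fc gc f'(1) g'(1))
      (simp_all add: subst_subst[symmetric])
qed

lemma invertible_conj:
  assumes "invertible f" shows "invertible (\<lambda>x. h @ f x @ word_inv h)"
proof -
  obtain g where g: "inv_compat g" "\<And>w. subst f (subst g w) \<simeq> w" "\<And>w. subst g (subst f w) \<simeq> w"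
    using assms unfolding invertible_def by blast
  note fc = invertible_inv_compat[OF assms]
  let ?f = "\<lambda>x. h @ f x @ word_inv h"
  define k where "k = subst g (word_inv h)"
  let ?g = "\<lambda>x. k @ g x @ word_inv k"
  have fk: "subst f k \<simeq> word_inv h" by (simp add: k_def g(2))
  have 1: "subst ?f (subst ?g w) \<simeq> w" for w
  proof -
    have "subst ?f (subst ?g w) \<simeq> h @ subst f (subst ?g w) @ word_inv h" by (rule subst_conj)
    also have "\<dots> = reduce (h @ (subst f (k @ subst g w @ word_inv k)) @ word_inv h)"
      by (intro free_eq_append refl subst_cong[OF fc] subst_conj)
    also have "\<dots> = reduce (h @ (subst f k @ subst f (subst g w) @ word_inv (subst f k)) @ word_inv h)"
      by (simp add: subst_word_inv[OF fc])
    also have "\<dots> = reduce (h @ (word_inv h @ w @ word_inv (word_inv h)) @ word_inv h)"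
      by (intro free_eq_append refl fk g(2) word_inv_cong)
    also have "\<dots> = reduce (h @ word_inv h @ (w @ h @ word_inv h))" by simp
    also have "\<dots> = reduce (w @ (h @ word_inv h))" by (rule cancel_left_inv)
    also have "\<dots> = reduce (w @ [])" by (intro free_eq_append refl self_append_inv)
    finally show ?thesis by simp
  qed
  have 2: "subst ?g (subst ?f w) \<simeq> w" for w
  proof -
    have "subst ?g (subst ?f w) \<simeq> k @ subst g (subst ?f w) @ word_inv k" by (rule subst_conj)
    also have "\<dots> = reduce (k @ (subst g (h @ subst f w @ word_inv h)) @ word_inv k)"
      by (intro free_eq_append refl subst_cong[OF g(1)] subst_conj)
    also have "\<dots> = reduce (k @ (subst g h @ subst g (subst f w) @ word_inv (subst g h)) @ word_inv k)"
      by (simp add: subst_word_inv[OF g(1)])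
    also have "\<dots> = reduce (k @ (subst g h @ w @ word_inv (subst g h)) @ word_inv k)"
      by (intro free_eq_append refl g(3))
    also have "\<dots> = reduce (k @ word_inv k @ (w @ k @ word_inv k))"
      by (simp add: k_def subst_word_inv[OF g(1)])
    also have "\<dots> = reduce (w @ (k @ word_inv k))" by (rule cancel_left_inv)
    also have "\<dots> = reduce (w @ [])" by (intro free_eq_append refl self_append_inv)
    finally show ?thesis by simp
  qed
  show ?thesis unfolding invertible_def
    by (intro conjI exI[of _ ?g] allI 1 2 inv_compat_conj fc g(1))
qed

lemma invertible_transvection: assumes "y \<notin> {x, bar x}" shows "invertible (transvection x y)"
  unfolding invertible_def
  using transvection_cancel[OF assms] transvection_cancel[of "bar y" x] assms
  by (intro conjI exI[of _ "transvection x (bar y)"] inv_compat_transvection)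
    (auto, metis bar_bar)

lemma invertible_reduce: assumes "invertible f" shows "invertible (\<lambda>x. reduce (f x))"
proof -
  obtain g where g: "inv_compat g" "\<And>w. subst f (subst g w) \<simeq> w" "\<And>w. subst g (subst f w) \<simeq> w"
    using assms unfolding invertible_def by blast
  note fc = invertible_inv_compat[OF assms]
  have rc: "inv_compat (\<lambda>x. reduce (f x))"
    using fc by (simp add: inv_compat_def reduce_word_inv)
  have eq: "subst (\<lambda>x. reduce (f x)) w \<simeq> subst f w" for w
    by (intro subst_eqI fc rc) simp_all
  show ?thesis unfolding invertible_def
    using rc g(1) eq g(2,3) subst_cong[OF g(1) eq] by (intro conjI exI[of _ g]) simp_all
qed

lemma invertible_neq_Nil: assumes "invertible f" shows "reduce (f x) \<noteq> []"
proof
  assume "reduce (f x) = []"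
  obtain g where g: "inv_compat g" "\<And>w. subst g (subst f w) \<simeq> w"
    using assms unfolding invertible_def by blast
  have "[x] \<simeq> subst g (f x)" using g(2)[of "[x]"] by simp
  also have "\<dots> = reduce (subst g [])"
    by (rule subst_cong[OF g(1)]) (simp add: \<open>reduce (f x) = []\<close>)
  finally show False by (simp add: reduce_def)
qed


section \<open>Nielsen reduction\<close>

text \<open>
  The quantity that Nielsen reduction decreases.
\<close>

definition basis_length :: "(letter \<Rightarrow> letter list) \<Rightarrow> nat" where
  "basis_length f = rlen (f A) + rlen (f B)"

text \<open>
  Any two letters that are neither equal nor inverse measure the same length, which makes all
  transvections accessible to one measure.
\<close>

lemma basis_length_eq:
  assumes "inv_compat f" "y \<notin> {x, bar x}"
  shows "basis_length f = rlen (f x) + rlen (f y)"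
proof -
  have "rlen (f A_inv) = rlen (f A)" "rlen (f B_inv) = rlen (f B)"
    using inv_compatD[OF assms(1), of A] inv_compatD[OF assms(1), of B] by simp_all
  then show ?thesis using assms(2) by (cases x; cases y) (auto simp: basis_length_def)
qed

lemma normal_form_letters:
  assumes "invertible f" "\<And>x. length (f x) = 1"
  shows "normal_form (subst f)"
proof -
  define s where "s x = hd (f x)" for x
  have f: "f x = [s x]" for x using assms(2)[of x] by (cases "f x") (auto simp: s_def)
  obtain g where g: "inv_compat g" "\<And>w. subst g (subst f w) \<simeq> w"
    using assms(1) unfolding invertible_def by blast
  have "signed s"
  proof (rule signed_if_inj)
    have "[x] \<simeq> [y]" if "s x = s y" for x y
      using g(2)[of "[x]"] g(2)[of "[y]"] that by (simp add: f)
    then show "inj s" by (auto intro!: injI simp: reduce_def)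
    show "s (bar x) = bar (s x)" for x
      using inv_compatD[OF invertible_inv_compat[OF assms(1)], of x] by (simp add: f)
  qed
  then show ?thesis
    using normal_form_map_left[OF normal_form_positive[of "[]"], of s] by (simp add: f[abs_def])
qed

text \<open>
  If no transvection followed by a conjugation shortens the basis, then the basis consists of letters.
  Minimality without conjugation bounds each cancellation between \<open>F x\<close> and \<open>F y\<close> with
  \<open>y \<noteq> x\<close> by half of either factor, and \<open>self_cancel\<close> does so strictly for \<open>y = x\<close>. A factor \<open>F y\<close>
  could still be consumed entirely, half from each side. Then the neighbours are equal, \<open>F y = p q\<close>
  and \<open>F x = q\<inverse> r p\<inverse>\<close>, and conjugating by \<open>p\<close> turns \<open>F y F x\<close> into \<open>r\<close> and
  \<open>F y\<close> into \<open>q p\<close>, which shortens the basis. Hence the system has the length property, and as each letter is the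
  image of a word, it is the image of a single letter.
\<close>

lemma Nielsen_irreducible_is_letters:
  assumes inv: "invertible F" and red: "\<And>x. reduced (F x)"
    and min: "\<And>x y h. y \<notin> {x, bar x} \<Longrightarrow>
      length (F x) + length (F y) \<le> rlen (h @ F x @ F y @ word_inv h) + rlen (h @ F y @ word_inv h)"
      "\<And>x y h. y \<notin> {x, bar x} \<Longrightarrow>
      length (F x) + length (F y) \<le> rlen (h @ F y @ F x @ word_inv h) + rlen (h @ F y @ word_inv h)"
  shows "length (F x) = 1"
proof -
  have Finv: "F (bar x) = word_inv (F x)" for x
    using inv by (rule invertible_inv_compat[THEN inv_compatD])
  have ne: "F x \<noteq> []" for x using invertible_neq_Nil[OF inv, of x] red by (simp add: reduce_reduced)
  have "\<forall>x y. \<exists>t. \<exists>s m. F x = s @ t \<and> F y = word_inv t @ m \<and> reduced (s @ m)"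
    using cancellation[OF red red] by metis
  then obtain T where T: "\<And>x y. \<exists>s m. F x = s @ T x y \<and> F y = word_inv (T x y) @ m \<and> reduced (s @ m)"
    by metis
  have rlenF: "rlen (F x) = length (F x)" for x by (simp add: reduce_reduced[OF red])
  have prod: "rlen (F x @ F y) + 2 * length (T x y) = length (F x) + length (F y)" for x y
  proof -
    obtain s m where "F x = s @ T x y" "F y = word_inv (T x y) @ m" "reduced (s @ m)"
      using T by blast
    from product_reduce[OF this] this show ?thesis by simp
  qed
  have half: "2 * length (T x y) \<le> length (F x)" "2 * length (T x y) \<le> length (F y)"
    if "y \<notin> {x, bar x}" for x y
  proof -
    show "2 * length (T x y) \<le> length (F y)"
      using min(1)[OF that, of "[]"] prod[of x y] by (simp add: rlenF)
    have "x \<notin> {y, bar y}" using that by auto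
    from min(2)[OF this, of "[]"] show "2 * length (T x y) \<le> length (F x)"
      using prod[of x y] by (simp add: rlenF)
  qed
  have self: "2 * length (T x x) < length (F x)" for x
    using T[of x x] self_cancel[OF red ne, of x] by blast
  have le: "2 * length (T x y) \<le> length (F x)" "2 * length (T x y) \<le> length (F y)"
    if "y \<noteq> bar x" for x y
    using that half[of y x] self[of x] by (cases "y = x"; simp)+
  have lt: "length (T x y) + length (T y z) < length (F y)" if xy: "y \<noteq> bar x" and yz: "z \<noteq> bar y" for x y z
  proof (rule ccontr)
    assume "\<not> ?thesis"
    with le[OF xy] le[OF yz] have eq: "2 * length (T x y) = length (F y)" "2 * length (T y z) = length (F y)"
      by linarith+
    with self[of y] have "x \<noteq> y" "z \<noteq> y" by auto
    obtain s m where Fx: "F x = s @ T x y" and Fy: "F y = word_inv (T x y) @ m" using T by blast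
    obtain s' m' where Fy': "F y = s' @ T y z" and Fz: "F z = word_inv (T y z) @ m'" using T by blast
    have Fy'': "F y = word_inv (T x y) @ T y z"
    proof -
      have "length (word_inv (T x y)) = length s'" using arg_cong[OF Fy', of length] eq by simp
      then have "m = T y z" using Fy Fy' by simp
      with Fy show ?thesis by simp
    qed
    have "z = x \<or> z = bar x"
      using \<open>x \<noteq> y\<close> \<open>z \<noteq> y\<close> xy yz by (cases x; cases y; cases z) auto
    then show False
    proof
      assume "z = bar x"
      then have "F x = word_inv m' @ T y z"
        using Fz Finv[of x] by (metis word_inv_append word_inv_word_inv)
      then have "T y z = T x y" using Fx eq by (metis append_eq_append_conv mult_cancel1 zero_neq_numeral)
      with Fy'' self_cancel[OF red ne, of y "word_inv (T x y)" "T x y" "T x y"] eq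
      show False by simp
    next
      assume zx: "z = x"
      define p where "p = word_inv (T x y)"
      define q where "q = T y x"
      have Fyq: "F y = p @ q" and lpq: "length p = length q" "length p + length q = length (F y)"
        using Fy'' eq zx by (auto simp: p_def q_def)
      have x1: "F x = s @ word_inv p" using Fx by (simp add: p_def)
      have x2: "F x = word_inv q @ m'" using Fz zx by (simp add: q_def)
      have "length p + length q \<le> length (F x)" using le(1)[OF xy] eq lpq by simp
      then have "length (word_inv q) \<le> length s" using arg_cong[OF x1, of length] by simp
      then obtain r where r: "F x = word_inv q @ r @ word_inv p"
        using x1 x2 by (metis append.assoc append_eq_append_conv_if append_take_drop_id)
      have "word_inv p @ F y @ F x @ word_inv (word_inv p) \<simeq> r"
      proof -
        have "word_inv p @ F y @ F x @ word_inv (word_inv p)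
            = word_inv p @ p @ (q @ word_inv q @ r @ word_inv p @ p)" by (simp add: Fyq r)
        also have "\<dots> \<simeq> q @ word_inv q @ (r @ word_inv p @ p)" by (rule cancel_inv_left)
        also have "\<dots> = reduce (r @ (word_inv p @ p))" by (rule cancel_left_inv)
        also have "\<dots> = reduce (r @ [])" by (intro free_eq_append refl inv_append_self)
        finally show ?thesis by simp
      qed
      then have len1: "rlen (word_inv p @ F y @ F x @ word_inv (word_inv p)) \<le> length r"
        by (metis rlen_le)
      have "word_inv p @ F y @ word_inv (word_inv p) \<simeq> q @ p"
        using cancel_inv_left[of p "q @ p"] by (simp add: Fyq)
      then have len2: "rlen (word_inv p @ F y @ word_inv (word_inv p)) \<le> length (q @ p)"
        by (metis rlen_le)
      have "y \<notin> {x, bar x}" using \<open>x \<noteq> y\<close> xy by auto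
      from min(2)[OF this, of "word_inv p"] len1 len2
      have "length (F x) \<le> length r" using lpq by simp
      with r have "q = []" "p = []" by auto
      then show False using Fyq ne by simp
    qed
  qed
  have lt1: "length (T x y) < length (F y)" if "y \<noteq> bar x" for x y
    using le(2)[OF that] ne[of y] by (cases "F y") auto
  have long: "length w \<le> rlen (subst F w)" if w: "reduced w" for w
  proof (cases w)
    case (Cons y v)
    define d where "d = (if v = [] then 0 else length (T y (hd v)))"
    obtain r where r: "reduce (subst F (y # v)) = take (length (F y) - d) (F y) @ r"
      "length v \<le> length r"
      using Nielsen_reduced_length[where F = F and T = T and y = y and w = v] T red lt lt1 w Cons
      unfolding d_def by blast
    have "d < length (F y)"
      using ne[of y] le(1)[of "hd v" y] w Cons
      by (cases "F y") (auto simp: d_def reduced_Cons)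
    then show ?thesis using r Cons by simp
  qed simp
  obtain g where g: "inv_compat g" "\<And>w. subst F (subst g w) \<simeq> w"
    using inv unfolding invertible_def by blast
  have ex: "\<exists>y. F y = [x]" for x
  proof -
    have Fg: "subst F (reduce (g x)) \<simeq> [x]"
      using subst_reduce[OF invertible_inv_compat[OF inv], of "g x"] g(2)[of "[x]"] by simp
    have x: "reduce [x] = [x]" by (simp add: reduce_def)
    have "length (reduce (g x)) \<le> 1"
      using long[of "reduce (g x)"] Fg x by simp
    moreover have "reduce (g x) \<noteq> []" using Fg x by auto
    ultimately obtain y where "reduce (g x) = [y]" by (cases "reduce (g x)") auto
    with Fg x show ?thesis by (auto simp: reduce_reduced[OF red])
  qed
  have "\<exists>\<sigma>. \<forall>x. F (\<sigma> x) = [x]" using ex by metis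
  then obtain \<sigma> where \<sigma>: "\<And>x. F (\<sigma> x) = [x]" by blast
  then have "signed \<sigma>" 
  proof (intro signed_if_inj)
    show "inj \<sigma>" using \<sigma> by (metis injI list.inject)
    show "\<sigma> (bar x) = bar (\<sigma> x)" for x
    proof -
      obtain g where g: "\<And>w. subst g (subst F w) \<simeq> w" using inv unfolding invertible_def by blast
      have "F (\<sigma> (bar x)) = F (bar (\<sigma> x))" by (simp add: \<sigma> Finv)
      then have "[\<sigma> (bar x)] \<simeq> [bar (\<sigma> x)]" using g[of "[\<sigma> (bar x)]"] g[of "[bar (\<sigma> x)]"] by simp
      then show ?thesis by (simp add: reduce_def)
    qed
  qed
  then obtain \<tau> where "\<And>x. \<sigma> (\<tau> x) = x" using signed_inv by metis
  then have "F x = [\<tau> x]" using \<sigma>[of "\<tau> x"] by simp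
  then show ?thesis by simp
qed

text \<open>
  Induction on the length of the basis: a shortening step is a transvection and a conjugation, and both
  can be undone inside the class of normal forms.
\<close>

lemma normal_form_invertible: "invertible f \<Longrightarrow> normal_form (subst f)"
proof (induction "basis_length f" arbitrary: f rule: less_induct)
  case less
  note fc = invertible_inv_compat[OF less.prems]
  let ?F = "\<lambda>x. reduce (f x)"
  note iF = invertible_reduce[OF less.prems]
  note Fc = invertible_inv_compat[OF iF]
  have eq: "subst f w \<simeq> subst ?F w" for w by (intro subst_eqI fc Fc) simp_all
  have step: "normal_form (subst f)" if xy: "y \<notin> {x, bar x}"
    and lt: "rlen (h @ subst ?F (transvection x y x) @ word_inv h) + rlen (h @ ?F y @ word_inv h)
        < length (?F x) + length (?F y)" for x y h
  proof -
    let ?f = "\<lambda>z. subst ?F (transvection x y z)"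
    let ?g = "\<lambda>z. h @ ?f z @ word_inv h"
    have g: "invertible ?g"
      by (intro invertible_conj invertible_comp iF invertible_transvection xy)
    have "basis_length ?g = rlen (?g x) + rlen (?g y)"
      by (rule basis_length_eq[OF invertible_inv_compat[OF g] xy])
    also have "\<dots> < basis_length f"
      using lt xy by (simp add: basis_length_eq[OF fc xy] transvection_def)
    finally have "normal_form (subst ?g)" by (rule less.hyps[OF _ g])
    then have "normal_form (\<lambda>w. subst ?g (subst (transvection x (bar y)) w))"
      by (rule normal_form_transvection) (use xy in auto)
    then show ?thesis
    proof (rule normal_form_conj[where k = "word_inv h"])
      fix w
      let ?u = "subst (transvection x (bar y)) w"
      have "word_inv h @ subst ?g ?u @ word_inv (word_inv h)
          \<simeq> word_inv h @ (h @ subst ?f ?u @ word_inv h) @ word_inv (word_inv h)"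
        by (intro free_eq_append refl subst_conj)
      also have "\<dots> = reduce (word_inv h @ h @ (subst ?f ?u @ word_inv h @ h))" by simp
      also have "\<dots> = reduce (subst ?f ?u @ (word_inv h @ h))" by (rule cancel_inv_left)
      also have "\<dots> = reduce (subst ?f ?u @ [])" by (intro free_eq_append refl inv_append_self)
      also have "\<dots> = reduce (subst ?F (subst (transvection x y) ?u))"
        by (simp only: subst_subst[of ?F] append_Nil2)
      also have "\<dots> = reduce (subst ?F w)"
        by (rule subst_cong[OF Fc transvection_cancel[OF xy]])
      finally show "subst f w \<simeq> word_inv h @ subst ?g ?u @ word_inv (word_inv h)"
        using eq[of w] by simp
    qed
  qed
  show ?case
  proof (rule ccontr)
    assume no: "\<not> normal_form (subst f)"
    have "length (?F x) = 1" for x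
    proof (rule Nielsen_irreducible_is_letters[OF iF])
      fix x y h assume xy: "y \<notin> {x, bar x}"
      show "length (?F x) + length (?F y)
          \<le> rlen (h @ ?F x @ ?F y @ word_inv h) + rlen (h @ ?F y @ word_inv h)"
        using step[OF xy, of h] no by (force simp: transvection_def)
      \<comment> \<open>Multiplication on the left is the transvection of the inverse letters.\<close>
      have xy': "bar y \<notin> {bar x, bar (bar x)}" using xy by auto
      have "length (?F (bar x)) + length (?F (bar y))
          \<le> rlen (h @ (?F (bar x) @ ?F (bar y)) @ word_inv h) + rlen (h @ ?F (bar y) @ word_inv h)"
        using step[OF xy', of h] no by (force simp: transvection_def)
      moreover have "rlen (h @ (?F (bar x) @ ?F (bar y)) @ word_inv h)
          = rlen (h @ ?F y @ ?F x @ word_inv h)"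
        using rlen_word_inv[of "h @ ?F y @ ?F x @ word_inv h"] by (simp add: inv_compatD[OF Fc])
      moreover have "rlen (h @ ?F (bar y) @ word_inv h) = rlen (h @ ?F y @ word_inv h)"
        using rlen_word_inv[of "h @ ?F y @ word_inv h"] by (simp add: inv_compatD[OF Fc])
      ultimately show "length (?F x) + length (?F y)
          \<le> rlen (h @ ?F y @ ?F x @ word_inv h) + rlen (h @ ?F y @ word_inv h)"
        by (simp add: inv_compatD[OF Fc])
    qed simp
    then have "normal_form (subst ?F)" by (intro normal_form_letters iF)
    then have "normal_form (subst f)" by (rule normal_form_cong) (rule eq)
    with no show False by simp
  qed
qed


section \<open>Minimality\<close>

lemma carrier_F2 [simp]: "w \<in> carrier F2 \<longleftrightarrow> reduced w"
  by (simp add: F2_def)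

lemma mult_F2 [simp]: "u \<otimes>\<^bsub>F2\<^esub> v = reduce (u @ v)"
  by (simp add: F2_def)

lemma hom_F2_subst:
  assumes "\<phi> \<in> hom F2 F2"
  shows "inv_compat (\<lambda>x. \<phi> [x])" "reduced w \<Longrightarrow> \<phi> w = reduce (subst (\<lambda>x. \<phi> [x]) w)"
proof -
  interpret group_hom F2 F2 \<phi>
    using assms group_F2 by (simp add: group_hom_def group_hom_axioms_def)
  have red: "reduced (\<phi> v)" if "reduced v" for v using hom_closed[of v] that by simp
  have "\<phi> [bar x] = word_inv (\<phi> [x])" for x
    using hom_inv[of "[x]"] inv_F2[of "[x]"] inv_F2[of "\<phi> [x]"] red[of "[x]"] by simp
  then show "inv_compat (\<lambda>x. \<phi> [x])" by (simp add: inv_compat_def)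
  show "\<phi> w = reduce (subst (\<lambda>x. \<phi> [x]) w)" if "reduced w"
    using that
  proof (induction w)
    case Nil
    show ?case using hom_one by (simp add: F2_def)
  next
    case (Cons x w)
    then have w: "reduced w" by (simp add: reduced_Cons)
    have "\<phi> (x # w) = \<phi> ([x] \<otimes>\<^bsub>F2\<^esub> w)" using Cons.prems by (simp add: reduce_reduced)
    also have "\<dots> = reduce (\<phi> [x] @ \<phi> w)" using hom_mult[of "[x]" w] w by simp
    also have "\<dots> = reduce (\<phi> [x] @ subst (\<lambda>x. \<phi> [x]) w)"
      using Cons.IH[OF w] by (simp add: reduce_append_right)
    finally show ?case by simp
  qed
qed

lemma auto_F2_invertible:
  assumes "\<phi> \<in> auto F2"
  obtains f where "invertible f" "\<And>w. reduced w \<Longrightarrow> \<phi> w = reduce (subst f w)"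
proof -
  interpret group F2 by (rule group_F2)
  define \<psi> where "\<psi> = restrict (inv_into (carrier F2) \<phi>) (carrier F2)"
  have hom: "\<phi> \<in> hom F2 F2" and bij: "\<phi> \<in> Bij (carrier F2)" using assms by (auto simp: auto_def)
  have hom': "\<psi> \<in> hom F2 F2" unfolding \<psi>_def by (rule restrict_inv_into_hom[OF hom bij])
  have bb: "bij_betw \<phi> (carrier F2) (carrier F2)" using bij by (simp add: Bij_def)
  have 1: "\<phi> (\<psi> w) = w" if "reduced w" for w
    using bij_betw_inv_into_right[OF bb, of w] that by (simp add: \<psi>_def)
  have 2: "\<psi> (\<phi> w) = w" if "reduced w" for w
  proof -
    have "reduced (\<phi> w)" using bij_betwE[OF bb] that by simp
    then show ?thesis using bij_betw_inv_into_left[OF bb, of w] that by (simp add: \<psi>_def)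
  qed
  let ?f = "\<lambda>x. \<phi> [x]" and ?g = "\<lambda>x. \<psi> [x]"
  note f = hom_F2_subst[OF hom] and g = hom_F2_subst[OF hom']
  have f': "reduce (subst ?f w) = \<phi> (reduce w)" for w
    using f(2)[of "reduce w"] subst_reduce[OF f(1), of w] by simp
  have g': "reduce (subst ?g w) = \<psi> (reduce w)" for w
    using g(2)[of "reduce w"] subst_reduce[OF g(1), of w] by simp
  have "invertible ?f"
    unfolding invertible_def
    by (intro conjI exI[of _ ?g] f(1) g(1)) (simp_all add: f' g' 1 2)
  then show thesis using f(2) by (rule that)
qed

lemma invertible_auto_F2:
  assumes "invertible f"
  shows "restrict (\<lambda>w. reduce (subst f w)) (carrier F2) \<in> auto F2"
proof -
  note fc = invertible_inv_compat[OF assms]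
  obtain g where g: "inv_compat g" "\<And>w. subst f (subst g w) \<simeq> w" "\<And>w. subst g (subst f w) \<simeq> w"
    using assms unfolding invertible_def by blast
  let ?\<phi> = "restrict (\<lambda>w. reduce (subst f w)) (carrier F2)"
  have "?\<phi> \<in> hom F2 F2"
  proof (rule homI)
    fix u v assume "u \<in> carrier F2" "v \<in> carrier F2"
    then show "?\<phi> (u \<otimes>\<^bsub>F2\<^esub> v) = ?\<phi> u \<otimes>\<^bsub>F2\<^esub> ?\<phi> v"
      using subst_reduce[OF fc, of "u @ v"] by (simp add: reduce_append_left reduce_append_right)
  qed simp
  moreover have "bij_betw ?\<phi> (carrier F2) (carrier F2)"
  proof (rule bij_betw_byWitness[where f' = "\<lambda>w. reduce (subst g w)"])
    show "\<forall>a\<in>carrier F2. reduce (subst g (?\<phi> a)) = a"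
      using g(3) by (simp add: subst_reduce[OF g(1)] reduce_reduced)
    show "\<forall>a\<in>carrier F2. ?\<phi> (reduce (subst g a)) = a"
      using g(2) by (simp add: subst_reduce[OF fc] reduce_reduced)
  qed auto
  ultimately show ?thesis by (simp add: auto_def Bij_def)
qed

lemma minimal_iff_invertible:
  "minimal w \<longleftrightarrow> reduced w \<and> (\<forall>f. invertible f \<longrightarrow> length w \<le> rlen (subst f w))"
proof (intro iffI conjI allI impI)
  assume w: "minimal w"
  then show "reduced w" by (simp add: minimal_def)
  show "length w \<le> rlen (subst f w)" if "invertible f" for f
    using w invertible_auto_F2[OF that] unfolding minimal_def by fastforce
next
  assume w: "reduced w \<and> (\<forall>f. invertible f \<longrightarrow> length w \<le> rlen (subst f w))"
  have "length w \<le> length (\<phi> w)" if "\<phi> \<in> auto F2" for \<phi>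
    using auto_F2_invertible[OF that] w by metis
  with w show "minimal w" by (simp add: minimal_def)
qed

text \<open>
  A local minimum of the cyclic length is a global one. The direction from minimality composes
  the transvection with an inner automorphism that attains the cyclic length. Conversely, bring the
  automorphism into normal form. The word is uphill after any signed permutation, so the positive
  product cannot shorten it cyclically.
\<close>

lemma minimal_iff_clen_transvection:
  assumes "w \<in> C2"
  shows "minimal w \<longleftrightarrow>
    (\<forall>x y. y \<notin> {x, bar x} \<longrightarrow> length w \<le> clen (subst (transvection x y) w))"
proof (intro iffI allI impI)
  fix x y assume min: "minimal w" and xy: "y \<notin> {x, bar x}"
  obtain h where h: "clen (subst (transvection x y) w)
      = rlen (h @ subst (transvection x y) w @ word_inv h)" by (rule clen_attained)
  have "invertible (\<lambda>z. h @ transvection x y z @ word_inv h)"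
    by (intro invertible_conj invertible_transvection xy)
  with min have "length w \<le> rlen (subst (\<lambda>z. h @ transvection x y z @ word_inv h) w)"
    unfolding minimal_iff_invertible by blast
  also have "\<dots> = rlen (h @ subst (transvection x y) w @ word_inv h)"
    by (rule arg_cong[OF subst_conj])
  finally show "length w \<le> clen (subst (transvection x y) w)" by (simp only: h)
next
  assume trans: "\<forall>x y. y \<notin> {x, bar x} \<longrightarrow> length w \<le> clen (subst (transvection x y) w)"
  have "length w \<le> rlen (subst f w)" if f: "invertible f" for f
  proof -
    obtain h s bs t where st: "signed s" "signed t"
      and nf: "\<And>w. subst f w \<simeq> h @ map s (positive bs (map t w)) @ word_inv h"
      using normal_form_invertible[OF f] unfolding normal_form_def by blast
    obtain r where r: "signed r" "\<And>x. t (r x) = x" "\<And>x. r (t x) = x"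
      using signed_inv[OF st(2)] by metis
    have tr: "clen (map t w) \<le> clen (subst (transvection x y) (map t w))" if "y \<notin> {x, bar x}" for x y
    proof -
      have "r y \<notin> {r x, bar (r x)}"
        using that signed_inj[OF r(1)] signed_bar[OF r(1)] by (metis insert_iff singletonD)
      with trans have "length w \<le> clen (subst (transvection (r x) (r y)) w)" by blast
      also have "\<dots> = clen (subst (transvection x y) (map t w))"
        using clen_transvection_map[OF st(2), of "r x" "r y" w] by (simp only: r(2))
      finally show ?thesis using clen_map[OF st(2), of w] clen_C2[OF assms] by simp
    qed
    have "uphill (map t w)" unfolding uphill_def using tr[of B A] tr[of A B] by simp
    then have "length w \<le> clen (positive bs (map t w))"
      using clen_positive[of "map t w" bs] clen_map[OF st(2), of w] clen_C2[OF assms] by simp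
    also have "\<dots> = clen (subst f w)"
      using clen_conj'[OF nf, of w] clen_map[OF st(1)] by simp
    also have "\<dots> \<le> rlen (subst f w)" by (rule clen_le)
    finally show ?thesis .
  qed
  with assms show "minimal w" by (simp add: minimal_iff_invertible C2_iff)
qed

lemma signed_extend:
  assumes "y \<notin> {x, bar x}"
  obtains s where "signed s" "s A = x" "s B = y"
proof
  let ?s = "\<lambda>z. case z of A \<Rightarrow> x | B \<Rightarrow> y | A_inv \<Rightarrow> bar x | B_inv \<Rightarrow> bar y"
  show "signed ?s"
  proof (rule signed_if_inj)
    show "inj ?s" using assms by (auto simp: inj_def split: letter.splits)
    show "?s (bar z) = bar (?s z)" for z by (cases z) auto
  qed
qed simp_all

lemma letter_exhaust_basis: "y \<notin> {x, bar x} \<Longrightarrow> z \<in> {x, bar x, y, bar y}"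
  by (cases x; cases y; cases z) auto

text \<open>
  Each \<open>x\<close> is counted at the transition after it and each \<open>x\<inverse>\<close> at the transition before it.
  Then the formula for the length of the image holds transition by transition.
\<close>

lemma clen_transvection_count:
  assumes w: "w \<in> C2" "2 \<le> length w" and xy: "y \<notin> {x, bar x}"
  shows "int (clen (subst (transvection x y) w)) = int (length w)
    + int (count_pm [x, x] w) + int (count_pm [x, y] w) - int (count_pm [x, bar y] w)"
proof -
  have ne: "w \<noteq> []" using w(2) by auto
  obtain s where s: "signed s" "s A = x" "s B = y" using signed_extend[OF xy] by metis
  have si: "s A_inv = bar x" "s B_inv = bar y"
    using signed_bar[OF s(1), of A] signed_bar[OF s(1), of B] s by simp_all
  let ?c = "\<lambda>p q. of_bool (p = x \<and> q = bar y \<or> p = y \<and> q = bar x) :: int"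
  let ?n = "\<lambda>u v p q. of_bool (p = u \<and> q = v) + of_bool (p = bar v \<and> q = bar u) :: int"
  have "(\<Sum>z\<leftarrow>w. of_bool (z \<in> {x, bar x}) :: int)
      = cyc_sum (\<lambda>p q. of_bool (p = x)) w + cyc_sum (\<lambda>p q. of_bool (q = bar x)) w"
  proof -
    have "(\<Sum>z\<leftarrow>w. of_bool (z \<in> {x, bar x}) :: int)
        = (\<Sum>z\<leftarrow>w. of_bool (z = x) + of_bool (z = bar x))"
      by (intro arg_cong[where f = sum_list] map_cong) auto
    then show ?thesis
      using cyc_sum_fst[OF ne, of "\<lambda>p. of_bool (p = x)"]
        cyc_sum_snd[OF ne, of "\<lambda>q. of_bool (q = bar x)"]
      by (simp add: sum_list_addf)
  qed
  moreover have "cyc_sum (\<lambda>p q. (of_bool (p = x) + of_bool (q = bar x)) + ?n x (bar y) p q) w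
      = cyc_sum (\<lambda>p q. (?n x x p q + ?n x y p q) + (?c p q + ?c p q)) w"
  proof (rule cyc_sum_cong[OF w(1) ne])
    fix p q assume "q \<noteq> bar p"
    then show "of_bool (p = x) + of_bool (q = bar x) + ?n x (bar y) p q
        = ?n x x p q + ?n x y p q + (?c p q + ?c p q)"
      using letter_exhaust_basis[OF xy, of p] letter_exhaust_basis[OF xy, of q] xy by auto
  qed
  then have "cyc_sum (\<lambda>p q. of_bool (p = x)) w + cyc_sum (\<lambda>p q. of_bool (q = bar x)) w
      + int (count_pm [x, bar y] w)
      = int (count_pm [x, x] w) + int (count_pm [x, y] w) + 2 * cyc_sum ?c w"
    unfolding cyc_sum_add[of "\<lambda>p q. of_bool (p = x) + of_bool (q = bar x)"]
      cyc_sum_add[of "\<lambda>p q. of_bool (p = x)"] cyc_sum_add[of "\<lambda>p q. ?n x x p q + ?n x y p q"]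
      cyc_sum_add[of "?n x x"] cyc_sum_add[of ?c] count_pm_eq_cyc_sum[OF w(2)]
    by simp
  ultimately show ?thesis
    using clen_transvection_C2[OF s(1) w(1) ne] by (simp only: s(2,3) si)
qed

lemma count_pm_flip: "count_pm [bar y, bar x] w = count_pm [x, y] w"
  by (simp add: count_pm_def word_inv_def)

text \<open>
  Conservation of flow: the cyclic word enters a letter as often as it leaves it. For \<open>x\<close> and for
  \<open>y\<close> this gives two equations between the four mixed counts, whose difference is the claim.
\<close>

lemma count_pm_commute:
  assumes w: "w \<in> C2" "2 \<le> length w" and xy: "y \<notin> {x, bar x}"
  shows "count_pm [y, x] w = count_pm [x, y] w"
proof -
  have ne: "w \<noteq> []" using w(2) by auto
  let ?n = "\<lambda>u v p q. of_bool (p = u \<and> q = v) + of_bool (p = bar v \<and> q = bar u) :: int"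
  have flow: "int (count_pm [x, y] w) + int (count_pm [x, bar y] w)
      = int (count_pm [y, x] w) + int (count_pm [bar y, x] w)" if xy: "y \<notin> {x, bar x}" for x y
  proof -
    have "cyc_sum (\<lambda>p q. (?n x y p q + ?n x (bar y) p q)
          + (of_bool (q = x) + of_bool (p = bar x))) w
        = cyc_sum (\<lambda>p q. (?n y x p q + ?n (bar y) x p q)
          + (of_bool (p = x) + of_bool (q = bar x))) w"
    proof (rule cyc_sum_cong[OF w(1) ne])
      fix p q assume "q \<noteq> bar p"
      then show "(?n x y p q + ?n x (bar y) p q) + (of_bool (q = x) + of_bool (p = bar x))
          = (?n y x p q + ?n (bar y) x p q) + (of_bool (p = x) + of_bool (q = bar x))"
        using letter_exhaust_basis[OF xy, of p] letter_exhaust_basis[OF xy, of q] xy by auto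
    qed
    then have "cyc_sum (?n x y) w + cyc_sum (?n x (bar y)) w
        = cyc_sum (?n y x) w + cyc_sum (?n (bar y) x) w"
      unfolding cyc_sum_add[of "\<lambda>p q. ?n x y p q + ?n x (bar y) p q"]
        cyc_sum_add[of "\<lambda>p q. ?n y x p q + ?n (bar y) x p q"]
        cyc_sum_add[of "?n x y"] cyc_sum_add[of "?n y x"]
        cyc_sum_add[of "\<lambda>p q. of_bool (q = x)"] cyc_sum_add[of "\<lambda>p q. of_bool (p = x)"]
        cyc_sum_fst[OF ne] cyc_sum_snd[OF ne]
      by simp
    then show ?thesis unfolding count_pm_eq_cyc_sum[OF w(2)] .
  qed
  have yx: "x \<notin> {y, bar y}" using xy by auto
  have "count_pm [x, bar y] w = count_pm [y, bar x] w" "count_pm [bar y, x] w = count_pm [bar x, y] w"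
    using count_pm_flip[of "bar y" x w] count_pm_flip[of y "bar x" w] by simp_all
  then show ?thesis using flow[OF xy] flow[OF yx] by linarith
qed

text \<open>
  The change of the cyclic length under the four transvections is \<open>(xx)\<close> or \<open>(yy)\<close> plus or minus the
  difference of the mixed counts. All four are nonnegative if and only if the inequality holds. For
  words with fewer than two letters all counts are zero, and such words are minimal because
  automorphisms are injective.
\<close>

lemma minimal_iff_count_pm:
  assumes w: "w \<in> C2" and xy: "x \<notin> {y, bar y}"
  shows "minimal w \<longleftrightarrow> \<bar>int (count_pm [y, x] w) - int (count_pm [y, bar x] w)\<bar>
    \<le> int (min (count_pm [x, x] w) (count_pm [y, y] w))"
proof (cases "2 \<le> length w")
  case True
  have yx: "y \<notin> {x, bar x}" using xy by auto
  let ?P = "\<lambda>u v. length w \<le> clen (subst (transvection u v) w)"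
  have Pbar: "?P (bar u) v \<longleftrightarrow> ?P u (bar v)" if "v \<notin> {u, bar u}" for u v
  proof -
    have "subst (transvection (bar u) v) w
        \<simeq> [bar v] @ subst (transvection u (bar v)) w @ word_inv [bar v]"
      using transvection_bar[OF that] by simp
    from clen_conj'[OF this] show ?thesis by simp
  qed
  have "(\<forall>u v. v \<notin> {u, bar u} \<longrightarrow> ?P u v) \<longleftrightarrow> ?P x y \<and> ?P x (bar y) \<and> ?P y x \<and> ?P y (bar x)"
  proof (intro iffI allI impI)
    assume "\<forall>u v. v \<notin> {u, bar u} \<longrightarrow> ?P u v"
    then show "?P x y \<and> ?P x (bar y) \<and> ?P y x \<and> ?P y (bar x)"
      using xy yx by auto
  next
    fix u v assume P: "?P x y \<and> ?P x (bar y) \<and> ?P y x \<and> ?P y (bar x)" and vu: "v \<notin> {u, bar u}"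
    have "u \<in> {x, bar x} \<and> v \<in> {y, bar y} \<or> u \<in> {y, bar y} \<and> v \<in> {x, bar x}"
      using letter_exhaust_basis[OF yx, of u] letter_exhaust_basis[OF yx, of v] vu by auto
    then show "?P u v"
      using P Pbar[of v x] Pbar[of v y] vu by auto
  qed
  then have min: "minimal w \<longleftrightarrow> ?P x y \<and> ?P x (bar y) \<and> ?P y x \<and> ?P y (bar x)"
    using minimal_iff_clen_transvection[OF w] by simp
  have comm: "count_pm [y, x] w = count_pm [x, y] w"
    by (rule count_pm_commute[OF w True yx])
  have flip: "count_pm [y, bar x] w = count_pm [x, bar y] w"
    using count_pm_flip[of "bar y" x w] by simp
  have ybar: "bar y \<notin> {x, bar x}" and xbar: "bar x \<notin> {y, bar y}" using xy yx by auto
  show ?thesis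
    unfolding min
    using clen_transvection_count[OF w True yx] clen_transvection_count[OF w True ybar]
      clen_transvection_count[OF w True xy] clen_transvection_count[OF w True xbar] comm flip
    by (simp only: bar_bar) linarith
next
  case False
  have "count_pm [u, v] w = 0" for u v
    using False by (simp add: count_pm_def occ_def)
  moreover have "minimal w"
  proof -
    have "length w \<le> rlen (subst f w)" if "invertible f" for f
    proof (cases w)
      case (Cons x u)
      then have "w = [x]" using False by (cases u) auto
      then show ?thesis using invertible_neq_Nil[OF that, of x] by (cases "reduce (f x)") auto
    qed simp
    with w show ?thesis by (simp add: minimal_iff_invertible C2_iff)
  qed
  ultimately show ?thesis by simp
qed

theorem theorem4:
  fixes w :: "letter list"
  assumes "w \<in> C2"
  shows
    "(minimal w \<longleftrightarrow>
        \<bar>int (count_pm [A, B] w) - int (count_pm [A, bar B] w)\<bar>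
          \<le> int (min (count_pm [A, A] w) (count_pm [B, B] w)))
     \<and> (\<bar>int (count_pm [A, B] w) - int (count_pm [A, bar B] w)\<bar>
          \<le> int (min (count_pm [A, A] w) (count_pm [B, B] w))
        \<longleftrightarrow>
        (\<exists>x y. x \<notin> {y, bar y}
          \<and> \<bar>int (count_pm [y, x] w) - int (count_pm [y, bar x] w)\<bar>
              \<le> int (min (count_pm [x, x] w) (count_pm [y, y] w))))"
proof -
  have "B \<notin> {A, bar A}" by simp
  with minimal_iff_count_pm[OF assms] show ?thesis
    using minimal_iff_count_pm[OF assms, of B A] by (metis min.commute)
qed

end
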